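(* Let $\mathcal{C},\mathcal{C}'$ be conjugacy classes of $S_n$ whose elements have $c_j$ (resp. $c'_j$) $j$-cycles, with $c=\sum_jc_j$, $c'=\sum_jc'_j$. Let $\pi\in\mathcal{C}$, $\pi'\in\mathcal{C}'$ be independent and uniform, and let $N_i$ be the number of orbits of size $i$ of $\langle\pi,\pi'\rangle$ on $\{1,\dots,n\}$. Let \[ B=\max\{(c_1+c^{1/2})(c'_1+{c'}^{1/2})/n,\,1\},\qquad D=\min\{c_1+c^{1/2},\,c'_1+{c'}^{1/2}\}. \] Then for all integers $k\geq1$ and $m_1,\dots,m_k\geq0$, writing $M=m_1\cdot1+\cdots+m_k\cdot k$, there is a constant $C_M$ depending only on $M$ such that \[ \left|\mathbf{E}[(N_1)_{m_1}\cdots(N_k)_{m_k}]-(\mathbf{E}N_1)^{m_1}\cdots(\mathbf{E}N_k)^{m_k}\right|\leq C_M\frac{B^M}{D^{2/3}} \] for all $n$ and all such classes. Also, for all $k,m\geq1$, with $N_{\leq k}=N_1+\cdots+N_k$, there is a constant $C_{k,m}$ depending only on $k,m$ such that \[ \left|\mathbf{E}[(N_{\leq k})_m]-(\mathbf{E}N_{\leq k})^m\right|\leq C_{k,m}\frac{B^{km}}{D^{2/3}}. \]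
   Context: $(x)_r=x(x-1)\cdots(x-r+1)$ denotes the falling factorial. *)

theory Defs
  imports Complex_Main "HOL-Combinatorics.Permutations"
begin

inductive_set gen_orbit :: "('a \<Rightarrow> 'a) set \<Rightarrow> 'a \<Rightarrow> 'a set"
  for G :: "('a \<Rightarrow> 'a) set" and x :: 'a where
  base: "x \<in> gen_orbit G x"
| step: "y \<in> gen_orbit G x \<Longrightarrow> f \<in> G \<Longrightarrow> f y \<in> gen_orbit G x"
| step_inv: "y \<in> gen_orbit G x \<Longrightarrow> f \<in> G \<Longrightarrow> inv f y \<in> gen_orbit G x"

definition orbits :: "('a \<Rightarrow> 'a) set \<Rightarrow> 'a set \<Rightarrow> 'a set set" where
  "orbits G S = gen_orbit G ` S"

definition num_orbits_of_size :: "('a \<Rightarrow> 'a) set \<Rightarrow> 'a set \<Rightarrow> nat \<Rightarrow> nat" where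
  "num_orbits_of_size G S i = card {Q \<in> orbits G S. card Q = i}"

definition cycle_count :: "nat \<Rightarrow> (nat \<Rightarrow> nat) \<Rightarrow> nat \<Rightarrow> nat" where
  "cycle_count n \<pi> j = num_orbits_of_size {\<pi>} {1..n} j"

definition total_cycles :: "nat \<Rightarrow> (nat \<Rightarrow> nat) \<Rightarrow> nat" where
  "total_cycles n \<pi> = (\<Sum>j=1..n. cycle_count n \<pi> j)"

definition conj_class :: "nat \<Rightarrow> (nat \<Rightarrow> nat) \<Rightarrow> (nat \<Rightarrow> nat) set" where
  "conj_class n \<pi> = {\<sigma> \<circ> \<pi> \<circ> inv \<sigma> | \<sigma>. \<sigma> permutes {1..n}}"

definition N :: "nat \<Rightarrow> (nat \<Rightarrow> nat) \<Rightarrow> (nat \<Rightarrow> nat) \<Rightarrow> nat \<Rightarrow> nat" where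
  "N n \<pi> \<pi>' i = num_orbits_of_size {\<pi>, \<pi>'} {1..n} i"

definition Exp :: "'a set \<Rightarrow> 'b set \<Rightarrow> ('a \<Rightarrow> 'b \<Rightarrow> real) \<Rightarrow> real" where
  "Exp C C' X = (\<Sum>p\<in>C \<times> C'. X (fst p) (snd p)) / real (card (C \<times> C'))"

definition falling :: "real \<Rightarrow> nat \<Rightarrow> real" where
  "falling x r = (\<Prod>i<r. x - real i)"

definition Bconst :: "nat \<Rightarrow> (nat \<Rightarrow> nat) \<Rightarrow> (nat \<Rightarrow> nat) \<Rightarrow> real" where
  "Bconst n \<pi> \<pi>' = max ((real (cycle_count n \<pi> 1) + sqrt (real (total_cycles n \<pi>)))
      * (real (cycle_count n \<pi>' 1) + sqrt (real (total_cycles n \<pi>'))) / real n) 1"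

definition Dconst :: "nat \<Rightarrow> (nat \<Rightarrow> nat) \<Rightarrow> (nat \<Rightarrow> nat) \<Rightarrow> real" where
  "Dconst n \<pi> \<pi>' = min (real (cycle_count n \<pi> 1) + sqrt (real (total_cycles n \<pi>)))
      (real (cycle_count n \<pi>' 1) + sqrt (real (total_cycles n \<pi>')))"

end

theory Submission
  imports Defs
begin

text \<open>
  Write \<open>F = c\<^sub>1 + c\<^bsup>1/2\<^esup>\<close>. Label every orbit by a block of an abstract set of size \<open>M\<close>: the joint
  factorial moment becomes, up to factorials, the expected number of injections of the union of
  the blocks whose block images are orbits. Averaging over conjugations replaces each such injection by a
  pair \<open>(f, g)\<close> of independent injections, where \<open>f\<close> only sees \<open>\<pi>\<close> and \<open>g\<close> only sees \<open>\<pi>'\<close>, divided by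
  the number of injections; being an orbit becomes a condition on each block separately. If injectivity
  is required only inside each block, the count of pairs factorizes exactly into the means.
  A union of cycles of total size \<open>a\<close> can be chosen in at most \<open>(2F)\<^sup>a\<close> ways, since \<open>c \<le> F\<^sup>2\<close> pays for every
  cycle of length at least 2, and fixing one of its points saves a factor \<open>F\<close>. Hence all pairs
  contribute \<open>O(B\<^sup>M)\<close>, and those where two blocks collide only \<open>O(B\<^sup>M / D)\<close>, which is stronger than claimed.
  The same error term covers the discrepancy between the numbers of injections, as \<open>D \<le> 2n\<close>.
\<close>

section \<open>Orbits as minimal stable sets\<close>

text \<open>The obstacle is that an orbit of the group depends on both permutations at once, so
  neither cycle type alone controls it. Describing orbits by stability and minimality, without a
  base point, turns the condition on the image of a block b into one on subsets s of b: \<pi> is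
  asked about the image of s under f, \<pi>' about its image under g, and f and g may then differ.
  For upper bounds minimality is thrown away, which leaves one condition on f and one on g. The
  sizes balance as follows. At most a constant times (F F')^M pairs over about n^M injections give
  (F F' / n)^M \<le> B^M. The product of means has the product of the numbers of injections of the
  single blocks as denominator; its relative gap to the joint denominator is of order 1/n, and D
  \<le> 2 n gives 1/n \<le> 2/D. If n < 2 M, both quantities lie between 0 and n^M while D \<le> 4
  M, so a constant is enough. The cumulative count is expanded over words of length m in the sizes
  1, ..., k, and each word is an instance of the joint bound.\<close>

lemma gen_orbit_subset:
  assumes G: "\<forall>f\<in>G. f permutes S" and x: "x \<in> R" and R: "\<forall>f\<in>G. f ` R = R"
  shows "gen_orbit G x \<subseteq> R"
proof
  fix y assume "y \<in> gen_orbit G x"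
  then show "y \<in> R"
  proof induction
    case base
    then show ?case by (rule x)
  next
    case (step y f)
    then show ?case using R by blast
  next
    case (step_inv y f)
    then obtain z where "z \<in> R" "y = f z" using R by blast
    moreover have "f permutes S" using G step_inv(2) by blast
    ultimately show ?case by (simp add: permutes_inverses(2))
  qed
qed

lemma gen_orbit_nonempty [simp]: "gen_orbit G x \<noteq> {}"
  using gen_orbit.base[of x G] by (metis empty_iff)

lemma gen_orbit_stable:
  assumes G: "\<forall>f\<in>G. f permutes S"
  shows "\<forall>f\<in>G. f ` gen_orbit G x = gen_orbit G x"
proof (intro ballI equalityI)
  fix f assume f: "f \<in> G"
  show "f ` gen_orbit G x \<subseteq> gen_orbit G x" using f by (auto intro: gen_orbit.step)
  show "gen_orbit G x \<subseteq> f ` gen_orbit G x"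
  proof
    fix y assume y: "y \<in> gen_orbit G x"
    then have "inv f y \<in> gen_orbit G x" using f by (rule gen_orbit.step_inv)
    moreover have "f permutes S" using G f by blast
    ultimately show "y \<in> f ` gen_orbit G x" by (metis imageI permutes_inverses(1))
  qed
qed

lemma permutes_image_Diff:
  assumes "f permutes S" "f ` A = A" "f ` R = R"
  shows "f ` (A - R) = A - R"
  using assms by (metis image_set_diff permutes_inj)

lemma permutes_image_Int:
  assumes "f permutes S" "f ` A = A" "f ` R = R"
  shows "f ` (A \<inter> R) = A \<inter> R"
  using assms by (metis image_Int permutes_inj)

text \<open>If R misses x, then its complement inside the orbit is again stable and contains x,
  hence is the whole orbit, which leaves R empty. Complements stay stable because permutations are
  injective.\<close>

lemma gen_orbit_minimal:
  assumes G: "\<forall>f\<in>G. f permutes S"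
    and R: "\<forall>f\<in>G. f ` R = R" "R \<noteq> {}" "R \<subseteq> gen_orbit G x"
  shows "R = gen_orbit G x"
proof (cases "x \<in> R")
  case True
  show ?thesis using gen_orbit_subset[OF G True R(1)] R(3) by (rule equalityI[rotated])
next
  case False
  have "gen_orbit G x \<subseteq> gen_orbit G x - R"
  proof (rule gen_orbit_subset[OF G])
    show "x \<in> gen_orbit G x - R" using False by (simp add: gen_orbit.base)
    show "\<forall>f\<in>G. f ` (gen_orbit G x - R) = gen_orbit G x - R"
      using permutes_image_Diff gen_orbit_stable[OF G] R(1) G by metis
  qed
  then show ?thesis using R(2,3) by blast
qed

text \<open>This form speaks only of images of subsets, with neither base points nor inverses. It is
  the form that can be transported along an injection and later divided between two maps.\<close>

lemma orbits_iff:
  assumes G: "\<forall>f\<in>G. f permutes S"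
  shows "Q \<in> orbits G S \<longleftrightarrow> Q \<subseteq> S \<and> Q \<noteq> {} \<and> (\<forall>f\<in>G. f ` Q = Q) \<and>
      (\<forall>R. R \<subset> Q \<and> R \<noteq> {} \<longrightarrow> \<not> (\<forall>f\<in>G. f ` R = R))"
proof
  assume "Q \<in> orbits G S"
  then obtain x where x: "x \<in> S" "Q = gen_orbit G x" by (auto simp: orbits_def)
  have "Q \<subseteq> S" unfolding x(2) by (rule gen_orbit_subset[OF G x(1)]) (use G in \<open>auto simp: permutes_image\<close>)
  moreover have "Q \<noteq> {}" by (simp add: x(2))
  moreover have "\<forall>f\<in>G. f ` Q = Q" unfolding x(2) by (rule gen_orbit_stable[OF G])
  moreover have "\<forall>R. R \<subset> Q \<and> R \<noteq> {} \<longrightarrow> \<not> (\<forall>f\<in>G. f ` R = R)"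
  proof (intro allI impI notI)
    fix R assume R: "R \<subset> Q \<and> R \<noteq> {}" "\<forall>f\<in>G. f ` R = R"
    have "R = gen_orbit G x" by (rule gen_orbit_minimal[OF G R(2)]) (use R(1) x(2) in auto)
    then show False using R(1) x(2) by blast
  qed
  ultimately show "Q \<subseteq> S \<and> Q \<noteq> {} \<and> (\<forall>f\<in>G. f ` Q = Q) \<and>
      (\<forall>R. R \<subset> Q \<and> R \<noteq> {} \<longrightarrow> \<not> (\<forall>f\<in>G. f ` R = R))" by (intro conjI)
next
  assume Q: "Q \<subseteq> S \<and> Q \<noteq> {} \<and> (\<forall>f\<in>G. f ` Q = Q) \<and>
      (\<forall>R. R \<subset> Q \<and> R \<noteq> {} \<longrightarrow> \<not> (\<forall>f\<in>G. f ` R = R))"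
  then obtain x where x: "x \<in> Q" by blast
  have "gen_orbit G x \<subseteq> Q" by (rule gen_orbit_subset[OF G x]) (use Q in simp)
  moreover have "\<not> gen_orbit G x \<subset> Q" using Q gen_orbit_stable[OF G, of x] gen_orbit_nonempty[of G x] by metis
  ultimately have "gen_orbit G x = Q" by blast
  then show "Q \<in> orbits G S" using x Q unfolding orbits_def by (metis imageI subsetD)
qed

text \<open>The intersection is stable and nonempty, so minimality of either orbit forbids it to be
  a proper subset.\<close>

lemma orbits_disjoint:
  assumes G: "\<forall>f\<in>G. f permutes S" and Q: "Q \<in> orbits G S" "R \<in> orbits G S" "Q \<inter> R \<noteq> {}"
  shows "Q = R"
proof -
  note Q' = Q(1)[unfolded orbits_iff[OF G]] and R' = Q(2)[unfolded orbits_iff[OF G]]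
  have st: "\<forall>f\<in>G. f ` (Q \<inter> R) = Q \<inter> R"
    using permutes_image_Int G Q' R' by metis
  have "\<not> Q \<inter> R \<subset> Q" using st Q' Q(3) by metis
  moreover have "\<not> Q \<inter> R \<subset> R" using st R' Q(3) by metis
  ultimately show ?thesis by blast
qed

section \<open>Counting stable sets of a single permutation\<close>

text \<open>These are the unions of cycles of \<pi> with a total of \<open>a\<close> points.\<close>

definition stable_sets :: "nat \<Rightarrow> (nat \<Rightarrow> nat) \<Rightarrow> nat \<Rightarrow> nat set set" where
  "stable_sets n \<pi> a = {Q. Q \<subseteq> {1..n} \<and> \<pi> ` Q = Q \<and> card Q = a}"

text \<open>The F of the overview: \<open>Bconst\<close> and \<open>Dconst\<close> are built from
  the weights of the two permutations by a maximum and a minimum.\<close>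

definition cycle_weight :: "nat \<Rightarrow> (nat \<Rightarrow> nat) \<Rightarrow> real" where
  "cycle_weight n \<pi> = real (cycle_count n \<pi> 1) + sqrt (real (total_cycles n \<pi>))"

lemma finite_stable_sets [simp]: "finite (stable_sets n \<pi> a)"
  unfolding stable_sets_def by (rule finite_subset[of _ "Pow {1..n}"]) auto

lemma finite_orbits:
  assumes "finite S" shows "finite (orbits G S)"
  using assms by (simp add: orbits_def)

lemma cycle_count_le_total: "cycle_count n \<pi> j \<le> total_cycles n \<pi>" if "1 \<le> j" "j \<le> n"
  unfolding total_cycles_def by (rule member_le_sum) (use that in auto)

lemma cycle_count_eq_0:
  assumes "\<pi> permutes {1..n}" "n < j"
  shows "cycle_count n \<pi> j = 0"
proof -
  have "{Q \<in> orbits {\<pi>} {1..n}. card Q = j} = {}"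
  proof (intro equals0I)
    fix Q assume "Q \<in> {Q \<in> orbits {\<pi>} {1..n}. card Q = j}"
    then have "Q \<subseteq> {1..n}" "card Q = j" using assms(1) orbits_iff[of "{\<pi>}"] by auto
    then show False using assms(2) card_mono[of "{1..n}" Q] by simp
  qed
  then show ?thesis unfolding cycle_count_def num_orbits_of_size_def by (metis card.empty)
qed

lemma total_cycles_pos:
  assumes "\<pi> permutes {1..n}" "1 \<le> n"
  shows "1 \<le> total_cycles n \<pi>"
proof -
  let ?Q = "gen_orbit {\<pi>} 1"
  have Q: "?Q \<in> orbits {\<pi>} {1..n}" using assms(2) by (auto simp: orbits_def)
  then have sub: "?Q \<subseteq> {1..n}" "?Q \<noteq> {}" using assms(1) orbits_iff[of "{\<pi>}" "{1..n}"] by auto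
  then have c: "1 \<le> card ?Q" "card ?Q \<le> n"
    using card_mono[OF _ sub(1)] card_gt_0_iff[of ?Q] finite_subset[OF sub(1)] by auto
  have "card {?Q} \<le> cycle_count n \<pi> (card ?Q)"
    unfolding cycle_count_def num_orbits_of_size_def by (rule card_mono) (use Q in \<open>auto simp: finite_orbits\<close>)
  then show ?thesis using cycle_count_le_total[OF c, of \<pi>] by simp
qed

text \<open>The lower bound makes powers of the weight increase with the exponent;
  \<open>total_cycles\<close> is positive because the cycle through the point 1 is counted.\<close>

lemma cycle_weight_ge_1:
  assumes "\<pi> permutes {1..n}" "1 \<le> n"
  shows "1 \<le> cycle_weight n \<pi>"
proof -
  have "1 \<le> sqrt (real (total_cycles n \<pi>))" using total_cycles_pos[OF assms] by simp
  then show ?thesis unfolding cycle_weight_def by linarith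
qed

text \<open>A cycle of length at least 2 contributes at least two points, so bounding their number by the
  total \<open>c \<le> F\<^sup>2\<close> loses nothing.\<close>

lemma cycle_count_le_weight_power:
  assumes \<pi>: "\<pi> permutes {1..n}" and n: "1 \<le> n" and l: "1 \<le> l"
  shows "real (cycle_count n \<pi> l) \<le> cycle_weight n \<pi> ^ l"
proof -
  have F: "1 \<le> cycle_weight n \<pi>" by (rule cycle_weight_ge_1[OF \<pi> n])
  consider "l = 1" | "2 \<le> l" "l \<le> n" | "n < l" using l by linarith
  then show ?thesis
  proof cases
    case 1
    then show ?thesis by (simp add: cycle_weight_def)
  next
    case 2
    have "real (cycle_count n \<pi> l) \<le> real (total_cycles n \<pi>)"
      using cycle_count_le_total[OF l 2(2)] by simp
    also have "\<dots> = sqrt (real (total_cycles n \<pi>)) ^ 2" by simp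
    also have "\<dots> \<le> cycle_weight n \<pi> ^ 2" by (rule power_mono) (auto simp: cycle_weight_def)
    also have "\<dots> \<le> cycle_weight n \<pi> ^ l" using F 2 by (intro power_increasing) auto
    finally show ?thesis .
  next
    case 3
    then show ?thesis using F cycle_count_eq_0[OF \<pi> 3] by simp
  qed
qed

text \<open>Remove the cycle of some point: if it has length \<open>l\<close>, then a stable set
  with \<open>a - l\<close> points remains. A set may arise from several such decompositions, which
  only helps an upper bound.\<close>

lemma card_stable_sets_recursion:
  assumes \<pi>: "\<pi> permutes {1..n}" and a: "1 \<le> a"
  shows "card (stable_sets n \<pi> a) \<le> (\<Sum>l=1..a. cycle_count n \<pi> l * card (stable_sets n \<pi> (a - l)))"
proof -
  define Orb where "Orb l = {Q \<in> orbits {\<pi>} {1..n}. card Q = l}" for l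
  have finOrb: "finite (Orb l)" for l by (simp add: Orb_def finite_orbits)
  have "stable_sets n \<pi> a \<subseteq> (\<Union>l\<in>{1..a}. (\<lambda>(P, R). P \<union> R) ` (Orb l \<times> stable_sets n \<pi> (a - l)))"
  proof
    fix Q assume "Q \<in> stable_sets n \<pi> a"
    then have Q: "Q \<subseteq> {1..n}" "\<pi> ` Q = Q" "card Q = a" by (auto simp: stable_sets_def)
    have fQ: "finite Q" using Q(1) finite_subset by blast
    from Q(3) a obtain x where x: "x \<in> Q" by fastforce
    let ?P = "gen_orbit {\<pi>} x"
    have PQ: "?P \<subseteq> Q" by (rule gen_orbit_subset[of _ "{1..n}"]) (use \<pi> x Q in auto)
    have P: "?P \<in> orbits {\<pi>} {1..n}" using x Q(1) by (auto simp: orbits_def)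
    have st: "\<pi> ` ?P = ?P" using gen_orbit_stable[of "{\<pi>}" "{1..n}" x] \<pi> by simp
    have fP: "finite ?P" using PQ fQ finite_subset by blast
    have c: "1 \<le> card ?P" "card ?P \<le> a"
      using gen_orbit_nonempty fP PQ fQ Q(3) card_mono[OF fQ PQ] by (auto simp: Suc_le_eq card_gt_0_iff)
    have "Q - ?P \<in> stable_sets n \<pi> (a - card ?P)"
      using Q PQ fP permutes_image_Diff[OF \<pi> Q(2) st] by (auto simp: stable_sets_def card_Diff_subset)
    moreover have "?P \<in> Orb (card ?P)" using P by (simp add: Orb_def)
    moreover have "Q = (\<lambda>(P, R). P \<union> R) (?P, Q - ?P)" using PQ by auto
    ultimately show "Q \<in> (\<Union>l\<in>{1..a}. (\<lambda>(P, R). P \<union> R) ` (Orb l \<times> stable_sets n \<pi> (a - l)))"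
      using c by (intro UN_I[of "card ?P"] image_eqI[where x = "(?P, Q - ?P)"]) auto
  qed
  then have "card (stable_sets n \<pi> a) \<le>
      card (\<Union>l\<in>{1..a}. (\<lambda>(P, R). P \<union> R) ` (Orb l \<times> stable_sets n \<pi> (a - l)))"
    by (intro card_mono) (auto simp: finOrb)
  also have "\<dots> \<le> (\<Sum>l=1..a. card ((\<lambda>(P, R). P \<union> R) ` (Orb l \<times> stable_sets n \<pi> (a - l))))"
    by (rule card_UN_le) simp
  also have "\<dots> \<le> (\<Sum>l=1..a. cycle_count n \<pi> l * card (stable_sets n \<pi> (a - l)))"
  proof (rule sum_mono)
    fix l
    have "card ((\<lambda>(P, R). P \<union> R) ` (Orb l \<times> stable_sets n \<pi> (a - l))) \<le> card (Orb l \<times> stable_sets n \<pi> (a - l))"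
      by (rule card_image_le) (simp add: finOrb)
    then show "card ((\<lambda>(P, R). P \<union> R) ` (Orb l \<times> stable_sets n \<pi> (a - l)))
        \<le> cycle_count n \<pi> l * card (stable_sets n \<pi> (a - l))"
      by (simp add: card_cartesian_product cycle_count_def num_orbits_of_size_def Orb_def)
  qed
  finally show ?thesis .
qed

text \<open>This geometric sum is the reason for the factor 2 per point in the next bound: it pays
  for the choice of the length of the removed cycle.\<close>

lemma sum_two_power_le: "(\<Sum>l=1..a. (2::real) ^ (a - l)) \<le> 2 ^ a"
proof -
  have "(\<Sum>l=1..a. (2::real) ^ (a - l)) = (\<Sum>l<a. 2 ^ l)"
    by (rule sum.reindex_bij_witness[of _ "\<lambda>l. a - l" "\<lambda>l. a - l"]) auto
  also have "\<dots> = 2 ^ a - 1" by (simp add: sum_gp_strict)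
  finally show ?thesis by simp
qed

text \<open>By strong induction, a cycle of length \<open>l\<close> can be chosen in at most F^l
  ways and the rest in at most (2F)^(a-l) ways. The powers of F combine to F^a whatever
  \<open>l\<close> is, and the powers of 2 sum to at most 2^a.\<close>

lemma card_stable_sets_le:
  assumes \<pi>: "\<pi> permutes {1..n}" and n: "1 \<le> n"
  shows "real (card (stable_sets n \<pi> a)) \<le> (2 * cycle_weight n \<pi>) ^ a"
proof (induction a rule: less_induct)
  case (less a)
  let ?F = "cycle_weight n \<pi>"
  have F: "1 \<le> ?F" by (rule cycle_weight_ge_1[OF \<pi> n])
  show ?case
  proof (cases "a = 0")
    case True
    have "stable_sets n \<pi> a \<subseteq> {{}}"
      using True by (auto simp: stable_sets_def dest: finite_subset)
    then have "card (stable_sets n \<pi> a) \<le> card {{}::nat set}" by (intro card_mono) auto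
    then show ?thesis using True by simp
  next
    case False
    have "real (card (stable_sets n \<pi> a)) \<le>
        real (\<Sum>l=1..a. cycle_count n \<pi> l * card (stable_sets n \<pi> (a - l)))"
      using card_stable_sets_recursion[OF \<pi>, of a] False by (simp only: of_nat_le_iff)
    also have "\<dots> = (\<Sum>l=1..a. real (cycle_count n \<pi> l) * real (card (stable_sets n \<pi> (a - l))))"
      by simp
    also have "\<dots> \<le> (\<Sum>l=1..a. ?F ^ l * (2 * ?F) ^ (a - l))"
      by (intro sum_mono mult_mono cycle_count_le_weight_power[OF \<pi> n] less) (use F in auto)
    also have "\<dots> = (\<Sum>l=1..a. ?F ^ a * 2 ^ (a - l))"
    proof (rule sum.cong)
      fix l assume "l \<in> {1..a}"
      then have "?F ^ a = ?F ^ l * ?F ^ (a - l)" by (simp flip: power_add)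
      then show "?F ^ l * (2 * ?F) ^ (a - l) = ?F ^ a * 2 ^ (a - l)" by (simp add: power_mult_distrib)
    qed simp
    also have "\<dots> = ?F ^ a * (\<Sum>l=1..a. 2 ^ (a - l))" by (simp add: sum_distrib_left)
    also have "\<dots> \<le> ?F ^ a * 2 ^ a" using F by (intro mult_left_mono sum_two_power_le) auto
    also have "\<dots> = (2 * ?F) ^ a" by (simp only: power_mult_distrib mult.commute)
    finally show ?thesis .
  qed
qed

text \<open>The cycle through x is forced to lie in Q, so Q is determined by what is left after
  removing it. At most \<open>a - 1\<close> points remain, which saves a factor 2F, recorded as
  F.\<close>

lemma card_stable_sets_containing_le:
  assumes \<pi>: "\<pi> permutes {1..n}" and n: "1 \<le> n"
  shows "real (card {Q \<in> stable_sets n \<pi> a. x \<in> Q}) \<le> (2 * cycle_weight n \<pi>) ^ a / cycle_weight n \<pi>"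
proof -
  let ?F = "cycle_weight n \<pi>" and ?P = "gen_orbit {\<pi>} x" and ?T = "{Q \<in> stable_sets n \<pi> a. x \<in> Q}"
  have F: "1 \<le> ?F" by (rule cycle_weight_ge_1[OF \<pi> n])
  show ?thesis
  proof (cases "?T = {}")
    case True
    then have "card ?T = 0" by (metis card.empty)
    then show ?thesis using F by (simp only: of_nat_0) simp
  next
    case False
    have PQ: "?P \<subseteq> Q" if "Q \<in> ?T" for Q
      by (rule gen_orbit_subset[of _ "{1..n}"]) (use \<pi> that in \<open>auto simp: stable_sets_def\<close>)
    have fQ: "finite Q" if "Q \<in> ?T" for Q
      using that finite_subset[of Q "{1..n}"] by (auto simp: stable_sets_def)
    obtain Q0 where Q0: "Q0 \<in> ?T" using False by blast
    have st: "\<pi> ` ?P = ?P" using gen_orbit_stable[of "{\<pi>}" "{1..n}" x] \<pi> by simp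
    have fP: "finite ?P" using PQ[OF Q0] fQ[OF Q0] finite_subset by blast
    have c: "1 \<le> card ?P" "card ?P \<le> a"
      using gen_orbit_nonempty fP card_mono[OF fQ[OF Q0] PQ[OF Q0]] Q0 by (auto simp: Suc_le_eq card_gt_0_iff stable_sets_def)
    have "card ?T \<le> card (stable_sets n \<pi> (a - card ?P))"
    proof (rule card_inj_on_le[where f = "\<lambda>Q. Q - ?P"])
      show "inj_on (\<lambda>Q. Q - ?P) ?T" using PQ by (intro inj_onI) blast
      show "(\<lambda>Q. Q - ?P) ` ?T \<subseteq> stable_sets n \<pi> (a - card ?P)"
      proof (rule image_subsetI)
        fix Q assume Q: "Q \<in> ?T"
        then show "Q - ?P \<in> stable_sets n \<pi> (a - card ?P)"
          using PQ[OF Q] fP permutes_image_Diff[OF \<pi> _ st, of Q]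
          by (auto simp: stable_sets_def card_Diff_subset)
      qed
    qed simp
    then have "real (card ?T) \<le> (2 * ?F) ^ (a - card ?P)"
      using card_stable_sets_le[OF \<pi> n, of "a - card ?P"] by linarith
    also have "\<dots> \<le> (2 * ?F) ^ (a - 1)" using F c by (intro power_increasing) auto
    also have "\<dots> = (2 * ?F) ^ a / (2 * ?F)" using F c by (simp add: power_diff)
    also have "\<dots> \<le> (2 * ?F) ^ a / ?F" using F by (intro divide_left_mono) auto
    finally show ?thesis .
  qed
qed

section \<open>Averaging over conjugacy classes\<close>

definition average :: "'a set \<Rightarrow> ('a \<Rightarrow> real) \<Rightarrow> real" where
  "average X \<phi> = (\<Sum>x\<in>X. \<phi> x) / real (card X)"

text \<open>Extensional functions: an injection is then determined by its values on A, so that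
  equality and counting concern A only.\<close>

definition inj_funs :: "'a set \<Rightarrow> 'b set \<Rightarrow> ('a \<Rightarrow> 'b) set" where
  "inj_funs A S = {f \<in> A \<rightarrow>\<^sub>E S. inj_on f A}"

text \<open>Under this predicate, identifying \<open>f ` b\<close> with \<open>g ` b\<close> along \<open>f\<close> and \<open>g\<close> turns the set into
  an orbit of the group generated by the two transported permutations.\<close>

definition glued :: "('b \<Rightarrow> 'b) \<Rightarrow> ('b \<Rightarrow> 'b) \<Rightarrow> 'a set \<Rightarrow> ('a \<Rightarrow> 'b) \<Rightarrow> ('a \<Rightarrow> 'b) \<Rightarrow> bool" where
  "glued \<pi> \<pi>' b f g \<longleftrightarrow> b \<noteq> {} \<and> \<pi> ` f ` b = f ` b \<and> \<pi>' ` g ` b = g ` b \<and>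
     (\<forall>s. s \<subset> b \<and> s \<noteq> {} \<longrightarrow> \<not> (\<pi> ` f ` s = f ` s \<and> \<pi>' ` g ` s = g ` s))"

lemma glued_cong:
  assumes "\<And>x. x \<in> b \<Longrightarrow> f x = f' x" "\<And>x. x \<in> b \<Longrightarrow> g x = g' x"
  shows "glued \<pi> \<pi>' b f g = glued \<pi> \<pi>' b f' g'"
proof -
  have "f ` s = f' ` s \<and> g ` s = g' ` s" if "s \<subseteq> b" for s
    using assms that by (auto intro!: image_cong)
  then show ?thesis unfolding glued_def by (metis psubset_imp_subset subset_refl)
qed

lemma finite_inj_funs [simp]: "finite A \<Longrightarrow> finite S \<Longrightarrow> finite (inj_funs A S)"
  unfolding inj_funs_def by (rule finite_subset[of _ "A \<rightarrow>\<^sub>E S"]) (auto intro: finite_PiE)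

lemma average_sum: "average X (\<lambda>x. \<Sum>f\<in>I. \<phi> x f) = (\<Sum>f\<in>I. average X (\<lambda>x. \<phi> x f))"
  unfolding average_def by (subst sum.swap) (simp add: sum_divide_distrib)

lemma average_cong: "X = Y \<Longrightarrow> (\<And>x. x \<in> Y \<Longrightarrow> \<phi> x = \<psi> x) \<Longrightarrow> average X \<phi> = average Y \<psi>"
  unfolding average_def by simp

text \<open>A map all of whose fibres have the same size carries the uniform distribution to the
  uniform distribution.\<close>

lemma average_fibers:
  assumes "finite X" and Y: "h ` X = Y" and r: "\<And>y. y \<in> Y \<Longrightarrow> card {x \<in> X. h x = y} = r"
  shows "average X (\<lambda>x. \<phi> (h x)) = average Y \<phi>"
proof (cases "X = {}")
  case True
  then show ?thesis using Y by (simp add: average_def)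
next
  case False
  \<comment> \<open>Stated for an arbitrary function because it is used twice: the constant 1 gives
    the ratio of the two cardinalities, and \<phi> gives the ratio of the two sums.\<close>
  have sum: "(\<Sum>x\<in>X. \<phi>' (h x)) = real r * (\<Sum>y\<in>Y. \<phi>' y)" for \<phi>' :: "'b \<Rightarrow> real"
  proof -
    have "(\<Sum>x\<in>X. \<phi>' (h x)) = (\<Sum>y\<in>Y. \<Sum>x | x \<in> X \<and> h x = y. \<phi>' (h x))"
      using assms(1) Y by (simp add: sum.image_gen[of X _ h])
    also have "\<dots> = (\<Sum>y\<in>Y. real r * \<phi>' y)" by (rule sum.cong) (auto simp flip: r)
    finally show ?thesis by (simp add: sum_distrib_left)
  qed
  have "real (card X) = real r * real (card Y)" using sum[of "\<lambda>_. 1"] by simp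
  moreover have "card X \<noteq> 0" using False assms(1) by simp
  ultimately show ?thesis using sum[of \<phi>] by (auto simp: average_def)
qed

text \<open>The fibres of conjugation are cosets of the centralizer of \<pi> and so have equal size.
  A uniform element of the class is therefore \<pi> conjugated by a uniform permutation.\<close>

lemma average_conj_class:
  assumes "\<pi> permutes {1..n}"
  shows "average (conj_class n \<pi>) \<phi> = average {\<tau>. \<tau> permutes {1..n}} (\<lambda>\<tau>. \<phi> (\<tau> \<circ> \<pi> \<circ> inv \<tau>))"
proof (rule average_fibers[symmetric, where r = "card {\<tau> \<in> {\<tau>. \<tau> permutes {1..n}}. \<tau> \<circ> \<pi> \<circ> inv \<tau> = \<pi>}"])
  show "finite {\<tau>. \<tau> permutes {1..n}}" by (simp add: finite_permutations)
  show "(\<lambda>\<tau>. \<tau> \<circ> \<pi> \<circ> inv \<tau>) ` {\<tau>. \<tau> permutes {1..n}} = conj_class n \<pi>"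
    by (auto simp: conj_class_def)
  fix y assume "y \<in> conj_class n \<pi>"
  then obtain \<rho> where \<rho>: "\<rho> permutes {1..n}" "y = \<rho> \<circ> \<pi> \<circ> inv \<rho>" by (auto simp: conj_class_def)
  have conj: "(\<rho> \<circ> \<tau>) \<circ> \<pi> \<circ> inv (\<rho> \<circ> \<tau>) = \<rho> \<circ> (\<tau> \<circ> \<pi> \<circ> inv \<tau>) \<circ> inv \<rho>" if "\<tau> permutes {1..n}" for \<tau>
    using that \<rho>(1) by (simp add: o_inv_distrib permutes_bij comp_assoc)
  have inv\<rho>: "inv \<rho> \<circ> \<rho> = id" "\<rho> \<circ> inv \<rho> = id" using permutes_inv_o[OF \<rho>(1)] by auto
  \<comment> \<open>Left multiplication by one fixed \<rho> that conjugates \<pi> to y maps the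
    centralizer onto the fibre over y.\<close>
  have "bij_betw (\<lambda>\<tau>. \<rho> \<circ> \<tau>) {\<tau> \<in> {\<tau>. \<tau> permutes {1..n}}. \<tau> \<circ> \<pi> \<circ> inv \<tau> = \<pi>}
      {\<tau> \<in> {\<tau>. \<tau> permutes {1..n}}. \<tau> \<circ> \<pi> \<circ> inv \<tau> = y}"
  proof (rule bij_betw_byWitness[where f' = "\<lambda>\<tau>. inv \<rho> \<circ> \<tau>"])
    show "\<forall>\<tau>\<in>{\<tau> \<in> {\<tau>. \<tau> permutes {1..n}}. \<tau> \<circ> \<pi> \<circ> inv \<tau> = \<pi>}. inv \<rho> \<circ> (\<rho> \<circ> \<tau>) = \<tau>"
      by (simp add: inv\<rho> flip: comp_assoc)
    show "\<forall>\<tau>\<in>{\<tau> \<in> {\<tau>. \<tau> permutes {1..n}}. \<tau> \<circ> \<pi> \<circ> inv \<tau> = y}. \<rho> \<circ> (inv \<rho> \<circ> \<tau>) = \<tau>"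
      by (simp add: inv\<rho> flip: comp_assoc)
    show "(\<lambda>\<tau>. \<rho> \<circ> \<tau>) ` {\<tau> \<in> {\<tau>. \<tau> permutes {1..n}}. \<tau> \<circ> \<pi> \<circ> inv \<tau> = \<pi>}
        \<subseteq> {\<tau> \<in> {\<tau>. \<tau> permutes {1..n}}. \<tau> \<circ> \<pi> \<circ> inv \<tau> = y}"
    proof (rule image_subsetI)
      fix \<tau> assume \<tau>: "\<tau> \<in> {\<tau> \<in> {\<tau>. \<tau> permutes {1..n}}. \<tau> \<circ> \<pi> \<circ> inv \<tau> = \<pi>}"
      then have "(\<rho> \<circ> \<tau>) \<circ> \<pi> \<circ> inv (\<rho> \<circ> \<tau>) = y" using conj[of \<tau>] \<rho>(2) by simp
      then show "\<rho> \<circ> \<tau> \<in> {\<tau> \<in> {\<tau>. \<tau> permutes {1..n}}. \<tau> \<circ> \<pi> \<circ> inv \<tau> = y}"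
        using permutes_compose \<tau> \<rho>(1) by blast
    qed
    show "(\<lambda>\<tau>. inv \<rho> \<circ> \<tau>) ` {\<tau> \<in> {\<tau>. \<tau> permutes {1..n}}. \<tau> \<circ> \<pi> \<circ> inv \<tau> = y}
        \<subseteq> {\<tau> \<in> {\<tau>. \<tau> permutes {1..n}}. \<tau> \<circ> \<pi> \<circ> inv \<tau> = \<pi>}"
    proof (rule image_subsetI)
      fix \<tau> assume \<tau>: "\<tau> \<in> {\<tau> \<in> {\<tau>. \<tau> permutes {1..n}}. \<tau> \<circ> \<pi> \<circ> inv \<tau> = y}"
      then have p: "inv \<rho> \<circ> \<tau> permutes {1..n}" using permutes_compose permutes_inv[OF \<rho>(1)] by blast
      have "inv (inv \<rho> \<circ> \<tau>) = inv \<tau> \<circ> \<rho>"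
        using \<tau> \<rho>(1) by (metis (no_types, lifting) mem_Collect_eq o_inv_distrib permutes_bij permutes_inv permutes_inv_inv)
      then have "(inv \<rho> \<circ> \<tau>) \<circ> \<pi> \<circ> inv (inv \<rho> \<circ> \<tau>) = inv \<rho> \<circ> (\<tau> \<circ> \<pi> \<circ> inv \<tau>) \<circ> \<rho>"
        by (simp add: comp_assoc)
      also have "\<dots> = inv \<rho> \<circ> (\<rho> \<circ> \<pi> \<circ> inv \<rho>) \<circ> \<rho>" using \<tau> \<rho>(2) by simp
      also have "\<dots> = (inv \<rho> \<circ> \<rho>) \<circ> \<pi> \<circ> (inv \<rho> \<circ> \<rho>)" by (simp only: comp_assoc)
      also have "\<dots> = \<pi>" by (simp add: inv\<rho>)
      finally show "inv \<rho> \<circ> \<tau> \<in> {\<tau> \<in> {\<tau>. \<tau> permutes {1..n}}. \<tau> \<circ> \<pi> \<circ> inv \<tau> = \<pi>}"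
        using p by blast
    qed
  qed
  then show "card {\<tau> \<in> {\<tau>. \<tau> permutes {1..n}}. \<tau> \<circ> \<pi> \<circ> inv \<tau> = y} =
      card {\<tau> \<in> {\<tau>. \<tau> permutes {1..n}}. \<tau> \<circ> \<pi> \<circ> inv \<tau> = \<pi>}"
    by (rule bij_betw_same_card[symmetric])
qed

section \<open>Uniform random injections from uniform random permutations\<close>

lemma permutes_between_injections:
  assumes "finite A" "finite S" "f \<in> inj_funs A S" "g \<in> inj_funs A S"
  obtains \<rho> where "\<rho> permutes S" "\<And>x. x \<in> A \<Longrightarrow> \<rho> (f x) = g x"
proof -
  have f: "f ` A \<subseteq> S" "inj_on f A" and g: "g ` A \<subseteq> S" "inj_on g A"
    using assms by (auto simp: inj_funs_def)
  have b1: "bij_betw (g \<circ> the_inv_into A f) (f ` A) (g ` A)"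
    using f(2) g(2) by (intro bij_betw_trans[where B = A] bij_betw_the_inv_into) (auto simp: bij_betw_def)
  \<comment> \<open>Both images have \<open>card A\<close> points, so their complements are
    equinumerous, and any bijection between them completes the prescribed values to a
    permutation.\<close>
  have "card (S - f ` A) = card (S - g ` A)"
    using assms f g by (simp add: card_Diff_subset card_image)
  then obtain h where h: "bij_betw h (S - f ` A) (S - g ` A)"
    using finite_same_card_bij assms(2) by (metis finite_Diff)
  define \<rho> where "\<rho> y = (if y \<in> f ` A then (g \<circ> the_inv_into A f) y else if y \<in> S then h y else y)" for y
  have "bij_betw \<rho> (f ` A \<union> (S - f ` A)) (g ` A \<union> (S - g ` A))"
  proof (rule bij_betw_combine)
    show "bij_betw \<rho> (f ` A) (g ` A)"
      using b1 by (rule bij_betw_cong[THEN iffD1, rotated]) (simp add: \<rho>_def)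
    show "bij_betw \<rho> (S - f ` A) (S - g ` A)"
      using h by (rule bij_betw_cong[THEN iffD1, rotated]) (simp add: \<rho>_def)
  qed auto
  then have "bij_betw \<rho> S S" using f(1) g(1) by (simp add: Un_absorb1)
  then have "\<rho> permutes S" by (rule bij_imp_permutes) (use f(1) in \<open>auto simp: \<rho>_def\<close>)
  moreover have "\<rho> (f x) = g x" if "x \<in> A" for x using that f(2) by (simp add: \<rho>_def the_inv_into_f_f)
  ultimately show ?thesis by (rule that)
qed

lemma restrict_comp_inj_funs:
  assumes "\<tau> permutes S" "f \<in> inj_funs A S"
  shows "restrict (\<tau> \<circ> f) A \<in> inj_funs A S"
proof -
  have "inj_on (\<tau> \<circ> f) A" using assms
    by (intro comp_inj_on) (auto simp: inj_funs_def intro: inj_on_subset[OF permutes_inj[OF assms(1)]])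
  then show ?thesis using assms by (auto simp: inj_funs_def permutes_in_image inj_on_restrict_eq)
qed

text \<open>The permutations act transitively on the injections, and the fibres of the orbit map are
  cosets of the pointwise stabilizer of the image of f. Hence the composite is uniform whatever f
  was; this is what later makes two composites with the same f independent.\<close>

lemma average_permuted_injection:
  assumes A: "finite A" "finite S" and f: "f \<in> inj_funs A S"
  shows "average {\<tau>. \<tau> permutes S} (\<lambda>\<tau>. \<phi> (restrict (inv \<tau> \<circ> f) A)) = average (inj_funs A S) \<phi>"
proof -
  have "average {\<tau>. \<tau> permutes S} (\<lambda>\<tau>. \<phi> (restrict (inv \<tau> \<circ> f) A)) =
      average {\<tau>. \<tau> permutes S} (\<lambda>\<tau>. \<phi> (restrict (\<tau> \<circ> f) A))"
    unfolding average_def by (subst sum_permutations_inverse) (simp add: permutes_inv_inv cong: sum.cong)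
  also have "\<dots> = average (inj_funs A S) \<phi>"
  proof (rule average_fibers[where r = "card {\<tau> \<in> {\<tau>. \<tau> permutes S}. restrict (\<tau> \<circ> f) A = f}"])
    show "finite {\<tau>. \<tau> permutes S}" using A by (simp add: finite_permutations)
    have ex: "\<exists>\<rho>. \<rho> permutes S \<and> restrict (\<rho> \<circ> f) A = g" if g: "g \<in> inj_funs A S" for g
    proof -
      obtain \<rho> where "\<rho> permutes S" "\<And>x. x \<in> A \<Longrightarrow> \<rho> (f x) = g x"
        using permutes_between_injections[OF A f g] by blast
      moreover from this have "restrict (\<rho> \<circ> f) A = g"
        using g by (intro extensionalityI[of _ A]) (auto simp: inj_funs_def PiE_def)
      ultimately show ?thesis by blast
    qed
    show "(\<lambda>\<tau>. restrict (\<tau> \<circ> f) A) ` {\<tau>. \<tau> permutes S} = inj_funs A S"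
      using ex restrict_comp_inj_funs[OF _ f] by (auto simp: image_iff)
    fix g assume "g \<in> inj_funs A S"
    then obtain \<rho> where \<rho>: "\<rho> permutes S" "restrict (\<rho> \<circ> f) A = g" using ex by blast
    have \<rho>f: "\<rho> (f x) = g x" if "x \<in> A" for x using that \<rho>(2) by auto
    have iff: "restrict (\<tau> \<circ> f) A = h \<longleftrightarrow> (\<forall>x\<in>A. \<tau> (f x) = h x)" if "h \<in> inj_funs A S" for \<tau> h
      using that by (auto simp: inj_funs_def PiE_def intro!: extensionalityI[of _ A])
    have inv\<rho>: "inv \<rho> \<circ> \<rho> = id" "\<rho> \<circ> inv \<rho> = id" using permutes_inv_o[OF \<rho>(1)] by auto
    have "bij_betw (\<lambda>\<tau>. \<rho> \<circ> \<tau>) {\<tau> \<in> {\<tau>. \<tau> permutes S}. restrict (\<tau> \<circ> f) A = f}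
       {\<tau> \<in> {\<tau>. \<tau> permutes S}. restrict (\<tau> \<circ> f) A = g}"
      unfolding iff[OF f] iff[OF \<open>g \<in> inj_funs A S\<close>]
    proof (rule bij_betw_byWitness[where f' = "\<lambda>\<tau>. inv \<rho> \<circ> \<tau>"])
      show "\<forall>\<tau>\<in>{\<tau> \<in> {\<tau>. \<tau> permutes S}. \<forall>x\<in>A. \<tau> (f x) = f x}. inv \<rho> \<circ> (\<rho> \<circ> \<tau>) = \<tau>"
        by (simp add: inv\<rho> flip: comp_assoc)
      show "\<forall>\<tau>\<in>{\<tau> \<in> {\<tau>. \<tau> permutes S}. \<forall>x\<in>A. \<tau> (f x) = g x}. \<rho> \<circ> (inv \<rho> \<circ> \<tau>) = \<tau>"
        by (simp add: inv\<rho> flip: comp_assoc)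
      show "(\<lambda>\<tau>. \<rho> \<circ> \<tau>) ` {\<tau> \<in> {\<tau>. \<tau> permutes S}. \<forall>x\<in>A. \<tau> (f x) = f x}
          \<subseteq> {\<tau> \<in> {\<tau>. \<tau> permutes S}. \<forall>x\<in>A. \<tau> (f x) = g x}"
        using permutes_compose[OF _ \<rho>(1)] \<rho>f by auto
      show "(\<lambda>\<tau>. inv \<rho> \<circ> \<tau>) ` {\<tau> \<in> {\<tau>. \<tau> permutes S}. \<forall>x\<in>A. \<tau> (f x) = g x}
          \<subseteq> {\<tau> \<in> {\<tau>. \<tau> permutes S}. \<forall>x\<in>A. \<tau> (f x) = f x}"
        using permutes_compose[OF _ permutes_inv[OF \<rho>(1)]] \<rho>f permutes_inverses(2)[OF \<rho>(1)]
        by (auto simp flip: \<rho>f)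
    qed
    then show "card {\<tau> \<in> {\<tau>. \<tau> permutes S}. restrict (\<tau> \<circ> f) A = g} =
       card {\<tau> \<in> {\<tau>. \<tau> permutes S}. restrict (\<tau> \<circ> f) A = f}"
      by (rule bij_betw_same_card[symmetric])
  qed
  finally show ?thesis .
qed

text \<open>On the diagonal f = g, \<open>glued\<close> is exactly the orbit condition: by
  injectivity the proper subsets of the image correspond to the proper subsets of the block, so
  minimality transfers.\<close>

lemma image_in_orbits_iff_glued:
  assumes \<pi>: "\<pi> permutes S" "\<pi>' permutes S" and f: "inj_on f b" "f ` b \<subseteq> S"
  shows "f ` b \<in> orbits {\<pi>, \<pi>'} S \<longleftrightarrow> glued \<pi> \<pi>' b f f"
proof -
  have "(\<forall>R. R \<subset> f ` b \<and> R \<noteq> {} \<longrightarrow> \<not> (\<pi> ` R = R \<and> \<pi>' ` R = R)) \<longleftrightarrow>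
      (\<forall>s. s \<subset> b \<and> s \<noteq> {} \<longrightarrow> \<not> (\<pi> ` f ` s = f ` s \<and> \<pi>' ` f ` s = f ` s))" (is "?L \<longleftrightarrow> ?R")
  proof
    assume L: ?L
    show ?R
    proof (intro allI impI)
      fix s assume s: "s \<subset> b \<and> s \<noteq> {}"
      then have "f ` s \<subset> f ` b \<and> f ` s \<noteq> {}" using f(1) by (metis image_is_empty image_strict_mono)
      then show "\<not> (\<pi> ` f ` s = f ` s \<and> \<pi>' ` f ` s = f ` s)" using L by blast
    qed
  next
    assume R: ?R
    show ?L
    proof (intro allI impI)
      fix R' assume R': "R' \<subset> f ` b \<and> R' \<noteq> {}"
      then obtain s where s: "s \<subseteq> b" "R' = f ` s" by (metis psubset_imp_subset subset_imageE)
      then have "s \<subset> b \<and> s \<noteq> {}" using R' by blast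
      then show "\<not> (\<pi> ` R' = R' \<and> \<pi>' ` R' = R')" using R s(2) by blast
    qed
  qed
  then show ?thesis using \<pi> f(2) by (simp add: orbits_iff glued_def)
qed

text \<open>Conjugation moves from the permutations to the maps, each map receiving its own
  conjugator. This separates f from g even when the same map is put in both places.\<close>

lemma glued_conj:
  assumes "\<tau> permutes S" "\<tau>' permutes S"
  shows "glued (\<tau> \<circ> \<pi> \<circ> inv \<tau>) (\<tau>' \<circ> \<pi>' \<circ> inv \<tau>') b f g \<longleftrightarrow> glued \<pi> \<pi>' b (inv \<tau> \<circ> f) (inv \<tau>' \<circ> g)"
proof -
  have *: "(\<sigma> \<circ> \<rho> \<circ> inv \<sigma>) ` X = X \<longleftrightarrow> \<rho> ` inv \<sigma> ` X = inv \<sigma> ` X" if "\<sigma> permutes S" for \<sigma> \<rho> :: "'a \<Rightarrow> 'a" and X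
  proof -
    have inv: "inv \<sigma> \<circ> \<sigma> = id" "\<sigma> \<circ> inv \<sigma> = id" using permutes_inv_o[OF that] by auto
    have "\<sigma> ` inv \<sigma> ` X = X" using inv(2) by (simp add: image_comp)
    then have "(\<sigma> \<circ> \<rho> \<circ> inv \<sigma>) ` X = X \<longleftrightarrow> \<sigma> ` \<rho> ` inv \<sigma> ` X = \<sigma> ` inv \<sigma> ` X"
      by (metis image_comp)
    also have "\<dots> \<longleftrightarrow> \<rho> ` inv \<sigma> ` X = inv \<sigma> ` X"
      using permutes_inj[OF that] by (simp add: inj_image_eq_iff)
    finally show ?thesis .
  qed
  show ?thesis unfolding glued_def *[OF assms(1)] *[OF assms(2)] by (simp add: image_comp)
qed

lemma permutes_conj:
  assumes "\<pi> permutes S" "\<tau> permutes S"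
  shows "\<tau> \<circ> \<pi> \<circ> inv \<tau> permutes S"
  using assms by (intro permutes_compose permutes_inv)

lemma Exp_eq_average: "Exp C C' X = average C (\<lambda>p. average C' (\<lambda>q. X p q))"
proof -
  have "(\<Sum>p\<in>C \<times> C'. X (fst p) (snd p)) = (\<Sum>p\<in>C. \<Sum>q\<in>C'. X p q)"
    by (simp add: sum.cartesian_product case_prod_beta)
  then show ?thesis unfolding Exp_def average_def
    by (simp add: card_cartesian_product mult.commute flip: sum_divide_distrib)
qed

text \<open>Sum over the embeddings first. For a fixed f the two conjugators turn it into two
  independent uniform injections, so the probability that all blocks become orbits is the proportion
  of pairs satisfying \<open>glued\<close> everywhere, the same for every f.\<close>

lemma Exp_card_orbit_embeddings:
  assumes \<pi>: "\<pi> permutes {1..n}" "\<pi>' permutes {1..n}" and P: "finite (\<Union>P)"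
  defines "I \<equiv> inj_funs (\<Union>P) {1..n}"
  shows "Exp (conj_class n \<pi>) (conj_class n \<pi>')
      (\<lambda>p q. real (card {f \<in> I. \<forall>b\<in>P. f ` b \<in> orbits {p, q} {1..n}})) =
    real (card {(f, g). f \<in> I \<and> g \<in> I \<and> (\<forall>b\<in>P. glued \<pi> \<pi>' b f g)}) / real (card I)"
proof -
  let ?C = "conj_class n \<pi>" and ?C' = "conj_class n \<pi>'" and ?T = "{\<tau>. \<tau> permutes {1..n}}"
  define \<psi> :: "_ \<Rightarrow> _ \<Rightarrow> _ \<Rightarrow> real" where "\<psi> p q f = of_bool (\<forall>b\<in>P. f ` b \<in> orbits {p, q} {1..n})" for p q f
  define \<chi> :: "_ \<Rightarrow> _ \<Rightarrow> real" where "\<chi> f g = of_bool (\<forall>b\<in>P. glued \<pi> \<pi>' b f g)" for f g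
  have finI: "finite I" using P by (simp add: I_def)
  have \<psi>\<chi>: "\<psi> (\<tau> \<circ> \<pi> \<circ> inv \<tau>) (\<tau>' \<circ> \<pi>' \<circ> inv \<tau>') f =
      \<chi> (restrict (inv \<tau> \<circ> f) (\<Union>P)) (restrict (inv \<tau>' \<circ> f) (\<Union>P))"
    if t: "\<tau> \<in> ?T" "\<tau>' \<in> ?T" "f \<in> I" for \<tau> \<tau>' f
  proof -
    have "f ` b \<in> orbits {\<tau> \<circ> \<pi> \<circ> inv \<tau>, \<tau>' \<circ> \<pi>' \<circ> inv \<tau>'} {1..n} \<longleftrightarrow>
        glued \<pi> \<pi>' b (restrict (inv \<tau> \<circ> f) (\<Union>P)) (restrict (inv \<tau>' \<circ> f) (\<Union>P))" if b: "b \<in> P" for b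
    proof -
      have f: "inj_on f b" "f ` b \<subseteq> {1..n}"
        using t(3) b unfolding I_def inj_funs_def by (auto intro: inj_on_subset)
      have "f ` b \<in> orbits {\<tau> \<circ> \<pi> \<circ> inv \<tau>, \<tau>' \<circ> \<pi>' \<circ> inv \<tau>'} {1..n} \<longleftrightarrow>
          glued (\<tau> \<circ> \<pi> \<circ> inv \<tau>) (\<tau>' \<circ> \<pi>' \<circ> inv \<tau>') b f f"
        by (rule image_in_orbits_iff_glued) (use t \<pi> f in \<open>auto intro: permutes_conj\<close>)
      also have "\<dots> \<longleftrightarrow> glued \<pi> \<pi>' b (inv \<tau> \<circ> f) (inv \<tau>' \<circ> f)"
        using t by (intro glued_conj) auto
      also have "\<dots> \<longleftrightarrow> glued \<pi> \<pi>' b (restrict (inv \<tau> \<circ> f) (\<Union>P)) (restrict (inv \<tau>' \<circ> f) (\<Union>P))"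
        by (rule glued_cong) (use b in auto)
      finally show ?thesis .
    qed
    then show ?thesis by (simp add: \<psi>_def \<chi>_def)
  qed
  have "Exp ?C ?C' (\<lambda>p q. real (card {f \<in> I. \<forall>b\<in>P. f ` b \<in> orbits {p, q} {1..n}})) =
      Exp ?C ?C' (\<lambda>p q. \<Sum>f\<in>I. \<psi> p q f)"
    using finI by (simp add: \<psi>_def of_bool_def sum.If_cases Int_def)
  also have "\<dots> = (\<Sum>f\<in>I. average ?C (\<lambda>p. average ?C' (\<lambda>q. \<psi> p q f)))"
    by (simp add: Exp_eq_average average_sum)
  also have "\<dots> = (\<Sum>f\<in>I. average I (\<lambda>g. average I (\<lambda>h. \<chi> g h)))"
  proof (rule sum.cong)
    fix f assume f: "f \<in> I"
    have "average ?C (\<lambda>p. average ?C' (\<lambda>q. \<psi> p q f)) =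
        average ?T (\<lambda>\<tau>. average ?T (\<lambda>\<tau>'. \<psi> (\<tau> \<circ> \<pi> \<circ> inv \<tau>) (\<tau>' \<circ> \<pi>' \<circ> inv \<tau>') f))"
      by (simp only: average_conj_class[OF \<pi>(1)] average_conj_class[OF \<pi>(2)])
    also have "\<dots> = average ?T (\<lambda>\<tau>. average ?T (\<lambda>\<tau>'.
        \<chi> (restrict (inv \<tau> \<circ> f) (\<Union>P)) (restrict (inv \<tau>' \<circ> f) (\<Union>P))))"
      using \<psi>\<chi>[OF _ _ f] by (intro average_cong) auto
    also have "\<dots> = average ?T (\<lambda>\<tau>. average I (\<chi> (restrict (inv \<tau> \<circ> f) (\<Union>P))))"
      using f P unfolding I_def by (intro average_cong average_permuted_injection) auto
    also have "\<dots> = average I (\<lambda>g. average I (\<chi> g))"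
      using f P unfolding I_def by (intro average_permuted_injection[where \<phi> = "\<lambda>g. average _ (\<chi> g)"]) auto
    finally show "average ?C (\<lambda>p. average ?C' (\<lambda>q. \<psi> p q f)) = average I (\<lambda>g. average I (\<lambda>h. \<chi> g h))" .
  qed simp
  \<comment> \<open>The summand no longer depends on f, so the outer sum contributes
    \<open>card I\<close> and cancels one of the two denominators.\<close>
  also have "\<dots> = (\<Sum>g\<in>I. \<Sum>h\<in>I. \<chi> g h) / real (card I)"
    by (auto simp: average_def sum_divide_distrib[symmetric])
  also have "(\<Sum>g\<in>I. \<Sum>h\<in>I. \<chi> g h) = (\<Sum>p\<in>I \<times> I. of_bool (\<forall>b\<in>P. glued \<pi> \<pi>' b (fst p) (snd p)))"
    by (simp add: sum.cartesian_product case_prod_beta \<chi>_def)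
  also have "\<dots> = real (card {(f, g). f \<in> I \<and> g \<in> I \<and> (\<forall>b\<in>P. glued \<pi> \<pi>' b f g)})"
    using finI by (auto simp: of_bool_def sum.If_cases intro!: arg_cong[where f = card])
  finally show ?thesis .
qed

section \<open>Functions on a disjoint union of blocks\<close>

text \<open>The relation \<open>R\<close> may couple the two restrictions, so the number of choices
  on \<open>b\<close> may depend on the choice on \<open>A\<close>. This is needed when a new block
  has to avoid orbits already taken, and when a coincidence ties a value on \<open>b\<close> to one
  on \<open>A\<close>.\<close>

lemma card_funcset_split:
  assumes disj: "A \<inter> b = {}" and fin: "finite A" "finite b" "finite Y"
  shows "card {h \<in> (A \<union> b) \<rightarrow>\<^sub>E Y. R (restrict h A) (restrict h b)} =
    (\<Sum>f\<in>A \<rightarrow>\<^sub>E Y. card {g \<in> b \<rightarrow>\<^sub>E Y. R f g})"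
proof -
  have "bij_betw (\<lambda>h. (restrict h A, restrict h b))
      {h \<in> (A \<union> b) \<rightarrow>\<^sub>E Y. R (restrict h A) (restrict h b)} (SIGMA f:A \<rightarrow>\<^sub>E Y. {g \<in> b \<rightarrow>\<^sub>E Y. R f g})"
  proof (rule bij_betw_byWitness[where f' = "\<lambda>(f, g). \<lambda>x. if x \<in> A then f x else g x"])
    show "\<forall>h\<in>{h \<in> (A \<union> b) \<rightarrow>\<^sub>E Y. R (restrict h A) (restrict h b)}.
        (case (restrict h A, restrict h b) of (f, g) \<Rightarrow> \<lambda>x. if x \<in> A then f x else g x) = h"
      by (auto simp: fun_eq_iff PiE_def extensional_def)
    have *: "restrict (\<lambda>x. if x \<in> A then f x else g x) A = f"
        "restrict (\<lambda>x. if x \<in> A then f x else g x) b = g"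
      if "f \<in> A \<rightarrow>\<^sub>E Y" "g \<in> b \<rightarrow>\<^sub>E Y" for f g
      using that disj by (auto simp: fun_eq_iff PiE_def extensional_def)
    then show "\<forall>p\<in>(SIGMA f:A \<rightarrow>\<^sub>E Y. {g \<in> b \<rightarrow>\<^sub>E Y. R f g}).
        (restrict (case p of (f, g) \<Rightarrow> \<lambda>x. if x \<in> A then f x else g x) A,
         restrict (case p of (f, g) \<Rightarrow> \<lambda>x. if x \<in> A then f x else g x) b) = p"
      by auto
    show "(\<lambda>h. (restrict h A, restrict h b)) ` {h \<in> (A \<union> b) \<rightarrow>\<^sub>E Y. R (restrict h A) (restrict h b)}
        \<subseteq> (SIGMA f:A \<rightarrow>\<^sub>E Y. {g \<in> b \<rightarrow>\<^sub>E Y. R f g})"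
      by auto
    show "(\<lambda>(f, g). \<lambda>x. if x \<in> A then f x else g x) ` (SIGMA f:A \<rightarrow>\<^sub>E Y. {g \<in> b \<rightarrow>\<^sub>E Y. R f g})
        \<subseteq> {h \<in> (A \<union> b) \<rightarrow>\<^sub>E Y. R (restrict h A) (restrict h b)}"
    proof (rule image_subsetI, clarify)
      fix f g assume fg: "f \<in> A \<rightarrow>\<^sub>E Y" "g \<in> b \<rightarrow>\<^sub>E Y" "R f g"
      have "(\<lambda>x. if x \<in> A then f x else g x) \<in> (A \<union> b) \<rightarrow>\<^sub>E Y"
        using fg(1,2) by (auto simp: PiE_def extensional_def)
      then show "(\<lambda>x. if x \<in> A then f x else g x) \<in> (A \<union> b) \<rightarrow>\<^sub>E Y \<and>
          R (restrict (\<lambda>x. if x \<in> A then f x else g x) A) (restrict (\<lambda>x. if x \<in> A then f x else g x) b)"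
        using *[OF fg(1,2)] fg(3) by simp
    qed
  qed
  then have "card {h \<in> (A \<union> b) \<rightarrow>\<^sub>E Y. R (restrict h A) (restrict h b)} =
      card (SIGMA f:A \<rightarrow>\<^sub>E Y. {g \<in> b \<rightarrow>\<^sub>E Y. R f g})"
    by (rule bij_betw_same_card)
  also have "\<dots> = (\<Sum>f\<in>A \<rightarrow>\<^sub>E Y. card {g \<in> b \<rightarrow>\<^sub>E Y. R f g})"
    using fin by (intro card_SigmaI) (auto simp: finite_PiE)
  finally show ?thesis .
qed

definition blocks :: "'a set set \<Rightarrow> bool" where
  "blocks P \<longleftrightarrow> finite P \<and> disjoint P \<and> (\<forall>b\<in>P. finite b \<and> b \<noteq> {})"

lemma blocks_insertD:
  assumes "blocks (insert b P)" "b \<notin> P"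
  shows "blocks P" "\<Union>P \<inter> b = {}" "finite (\<Union>P)" "finite b" "b \<noteq> {}"
  using assms unfolding blocks_def disjoint_def by auto

lemma blocks_finite_Union: "blocks P \<Longrightarrow> finite (\<Union>P)"
  by (simp add: blocks_def)

lemma blocks_card_Union:
  assumes "blocks P" shows "card (\<Union>P) = (\<Sum>b\<in>P. card b)"
  using assms by (intro card_Union_disjoint) (auto simp: blocks_def disjoint_def pairwise_def disjnt_def)

text \<open>The hypothesis \<open>cong\<close> says that each condition sees only its own block.
  Such conditions are met independently, so the count multiplies; the induction splits off one block
  at a time.\<close>

lemma card_funcset_blocks:
  assumes P: "blocks P" and Y: "finite Y"
    and cong: "\<And>b h h'. b \<in> P \<Longrightarrow> (\<And>x. x \<in> b \<Longrightarrow> h x = h' x) \<Longrightarrow> R b h = R b h'"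
  shows "card {h \<in> \<Union>P \<rightarrow>\<^sub>E Y. \<forall>b\<in>P. R b h} = (\<Prod>b\<in>P. card {h \<in> b \<rightarrow>\<^sub>E Y. R b h})"
proof -
  have "finite P" using P by (simp add: blocks_def)
  then show ?thesis using P cong
  proof (induction P rule: finite_induct)
    case empty
    have "{h. h = (\<lambda>x. undefined)} = {\<lambda>x. undefined}" by blast
    then show ?case by simp
  next
    case (insert b P)
    note B = blocks_insertD[OF insert.prems(1) insert.hyps(2)]
    have R: "R c h = R c h'" if "c \<in> insert b P" "\<And>x. x \<in> c \<Longrightarrow> h x = h' x" for c h h'
      using insert.prems(2) that by blast
    have "{h \<in> \<Union>(insert b P) \<rightarrow>\<^sub>E Y. \<forall>c\<in>insert b P. R c h} =
        {h \<in> (\<Union>P \<union> b) \<rightarrow>\<^sub>E Y. (\<forall>c\<in>P. R c (restrict h (\<Union>P))) \<and> R b (restrict h b)}"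
    proof -
      have "R b (restrict h b) = R b h" for h by (rule R) auto
      moreover have "R c (restrict h (\<Union>P)) = R c h" if "c \<in> P" for c h by (rule R) (use that in auto)
      ultimately show ?thesis by (simp add: Un_commute conj_commute)
    qed
    then have "card {h \<in> \<Union>(insert b P) \<rightarrow>\<^sub>E Y. \<forall>c\<in>insert b P. R c h} =
       card {h \<in> (\<Union>P \<union> b) \<rightarrow>\<^sub>E Y. (\<forall>c\<in>P. R c (restrict h (\<Union>P))) \<and> R b (restrict h b)}" by simp
    also have "\<dots> = (\<Sum>f\<in>\<Union>P \<rightarrow>\<^sub>E Y. card {g \<in> b \<rightarrow>\<^sub>E Y. (\<forall>c\<in>P. R c f) \<and> R b g})"
      using B Y by (intro card_funcset_split) auto
    also have "\<dots> = (\<Sum>f\<in>\<Union>P \<rightarrow>\<^sub>E Y. if \<forall>c\<in>P. R c f then card {g \<in> b \<rightarrow>\<^sub>E Y. R b g} else 0)"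
    proof (intro sum.cong refl)
      fix f
      show "card {g \<in> b \<rightarrow>\<^sub>E Y. (\<forall>c\<in>P. R c f) \<and> R b g} =
          (if \<forall>c\<in>P. R c f then card {g \<in> b \<rightarrow>\<^sub>E Y. R b g} else 0)"
      proof (cases "\<forall>c\<in>P. R c f")
        case True
        then show ?thesis by simp
      next
        case False
        then show ?thesis by (simp only: if_False simp_thms empty_def[symmetric] card.empty)
      qed
    qed
    also have "\<dots> = card {f \<in> \<Union>P \<rightarrow>\<^sub>E Y. \<forall>c\<in>P. R c f} * card {g \<in> b \<rightarrow>\<^sub>E Y. R b g}"
      using B Y by (simp add: sum.If_cases finite_PiE Int_def)
    also have "card {f \<in> \<Union>P \<rightarrow>\<^sub>E Y. \<forall>c\<in>P. R c f} = (\<Prod>c\<in>P. card {h \<in> c \<rightarrow>\<^sub>E Y. R c h})"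
      by (rule insert.IH[OF B(1)], rule R) auto
    finally show ?case using insert.hyps by (simp add: mult.commute)
  qed
qed

section \<open>Injections with prescribed images, and embeddings of blocks as orbits\<close>

lemma falling_Suc: "falling x (Suc r) = falling x r * (x - real r)"
  by (simp add: falling_def)

text \<open>Truncated subtraction is correct here: if A is larger than S, then the factor at
  \<open>i = card S\<close> vanishes.\<close>

lemma card_inj_funs:
  assumes "finite A" "finite S"
  shows "card (inj_funs A S) = (\<Prod>i<card A. card S - i)"
proof -
  have "card {f \<in> A \<rightarrow>\<^sub>E S. inj_on f A} = card S ^ (card A - card A) * prod ((-) (card S)) {0..<card A}"
    using assms by (intro card_inj_on_subset_funcset) auto
  then show ?thesis by (simp add: inj_funs_def lessThan_atLeast0)
qed

lemma prod_diff_eq_fact: "(\<Prod>i<a. a - i) = (fact a :: nat)"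
proof -
  have "(\<Prod>i<a. a - i) = \<Prod>{1..a}"
    by (rule prod.reindex_bij_witness[of _ "\<lambda>i. a - i" "\<lambda>i. a - i"]) auto
  then show ?thesis by (simp add: fact_prod)
qed

lemma inj_funs_image_eq:
  assumes "finite b" "finite Q" "card Q = card b"
  shows "{g \<in> inj_funs b S. g ` b = Q} = (if Q \<subseteq> S then inj_funs b Q else {})"
proof -
  have "g ` b = Q" if "g \<in> inj_funs b Q" for g
    using that assms by (intro card_seteq) (auto simp: inj_funs_def card_image)
  then show ?thesis by (auto simp: inj_funs_def)
qed

text \<open>An injection into a set of the same size is onto, so every admissible image receives one
  factorial's worth of maps, and different images receive different maps.\<close>

lemma card_inj_funs_onto:
  assumes b: "finite b" and S: "finite S" and QQ: "QQ \<subseteq> {Q. Q \<subseteq> S \<and> card Q = card b}"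
  shows "card {g \<in> inj_funs b S. g ` b \<in> QQ} = card QQ * fact (card b)"
proof -
  have finQQ: "finite QQ" by (rule finite_subset[OF QQ]) (use S in simp)
  have sub: "Q \<subseteq> S" "card Q = card b" "finite Q" if "Q \<in> QQ" for Q
    using QQ that S finite_subset[of Q S] by auto
  have "{g \<in> inj_funs b S. g ` b \<in> QQ} = (\<Union>Q\<in>QQ. {g \<in> inj_funs b S. g ` b = Q})" by blast
  also have "\<dots> = (\<Union>Q\<in>QQ. inj_funs b Q)"
    by (intro SUP_cong refl) (simp add: inj_funs_image_eq[OF b sub(3,2)] sub(1))
  also have "card \<dots> = (\<Sum>Q\<in>QQ. card (inj_funs b Q))"
  proof (rule card_UN_disjoint[OF finQQ])
    show "\<forall>Q\<in>QQ. finite (inj_funs b Q)" using sub b by simp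
    show "\<forall>Q\<in>QQ. \<forall>Q'\<in>QQ. Q \<noteq> Q' \<longrightarrow> inj_funs b Q \<inter> inj_funs b Q' = {}"
    proof (intro ballI impI equals0I)
      fix Q Q' g assume *: "Q \<in> QQ" "Q' \<in> QQ" "Q \<noteq> Q'" "g \<in> inj_funs b Q \<inter> inj_funs b Q'"
      have "g ` b = Q" using inj_funs_image_eq[OF b sub(3,2)[OF *(1)], of S] sub(1)[OF *(1)] *(4) by auto
      moreover have "g ` b = Q'" using inj_funs_image_eq[OF b sub(3,2)[OF *(2)], of S] sub(1)[OF *(2)] *(4) by auto
      ultimately show False using *(3) by simp
    qed
  qed
  also have "\<dots> = (\<Sum>Q\<in>QQ. fact (card b))"
    by (intro sum.cong refl) (use b sub in \<open>auto simp: card_inj_funs prod_diff_eq_fact\<close>)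
  finally show ?thesis by simp
qed

text \<open>Blocks of size i need distinct orbits of size i, which gives the falling factorial, and
  each block can be labelled by its orbit in i! ways. By induction on the blocks, a new block of
  size i has N_i - m_i orbits left. \<open>I\<close> may be any finite set containing the block
  sizes; a size without blocks contributes 1.\<close>

lemma card_orbit_embeddings:
  fixes P :: "'a set set" and S :: "'b set"
  assumes P: "blocks P" and I: "finite I" "card ` P \<subseteq> I" and S: "finite S"
    and G: "\<forall>f\<in>G. f permutes S"
  shows "real (card {f \<in> inj_funs (\<Union>P) S. \<forall>b\<in>P. f ` b \<in> orbits G S}) =
    (\<Prod>i\<in>I. falling (real (num_orbits_of_size G S i)) (card {b \<in> P. card b = i}) *
        fact i ^ card {b \<in> P. card b = i})"
proof -
  have "finite P" using P by (simp add: blocks_def)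
  then show ?thesis using P I(2)
  proof (induction P rule: finite_induct)
    case empty
    have "inj_funs ({} :: 'a set) S = {\<lambda>x. undefined}" by (auto simp: inj_funs_def)
    then show ?case by (simp add: falling_def)
  next
    case (insert b P)
    note B = blocks_insertD[OF insert.prems(1) insert.hyps(2)]
    let ?E = "{f \<in> inj_funs (\<Union>P) S. \<forall>c\<in>P. f ` c \<in> orbits G S}"
    let ?i = "card b"
    let ?m = "\<lambda>i. card {c \<in> P. card c = i}"
    let ?N = "\<lambda>i. real (num_orbits_of_size G S i)"
    have i: "?i \<in> I" using insert.prems(2) by simp
    have inj: "inj_on h (\<Union>P \<union> b) \<longleftrightarrow> inj_on h (\<Union>P) \<and> inj_on h b \<and> (\<forall>c\<in>P. h ` c \<inter> h ` b = {})" for h :: "'a \<Rightarrow> 'b"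
    proof -
      have "h ` \<Union>P \<inter> h ` b = {} \<longleftrightarrow> (\<forall>c\<in>P. h ` c \<inter> h ` b = {})" by blast
      moreover have "\<Union>P - b = \<Union>P" "b - \<Union>P = b" using B(2) by auto
      ultimately show ?thesis by (simp add: inj_on_Un)
    qed
    \<comment> \<open>Orbits are equal or disjoint, so injectivity across blocks reduces to the
      images being different sets.\<close>
    have orb: "h ` c \<inter> h ` b = {} \<longleftrightarrow> h ` c \<noteq> h ` b"
      if "h ` c \<in> orbits G S" "h ` b \<in> orbits G S" for h c
      using orbits_disjoint[OF G that] B(5) by auto
    \<comment> \<open>Everything is rewritten through the two restrictions, the shape in which the
      functions on the union can be split.\<close>
    have 1: "{h \<in> inj_funs (\<Union>(insert b P)) S. \<forall>c\<in>insert b P. h ` c \<in> orbits G S} =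
        {h \<in> (\<Union>P \<union> b) \<rightarrow>\<^sub>E S. restrict h (\<Union>P) \<in> ?E \<and> restrict h b \<in> inj_funs b S \<and>
            restrict h b ` b \<in> {Q \<in> orbits G S. card Q = ?i} - (\<lambda>c. restrict h (\<Union>P) ` c) ` P}"
      (is "?L = ?R")
    proof -
      have im: "restrict h (\<Union>P) ` c = h ` c" if "c \<in> P" for h :: "'a \<Rightarrow> 'b" and c
        using that by (intro image_cong) auto
      have imb: "restrict h b ` b = h ` b" for h :: "'a \<Rightarrow> 'b" by (intro image_cong) auto
      have ims: "(\<lambda>c. restrict h (\<Union>P) ` c) ` P = (\<lambda>c. h ` c) ` P" for h :: "'a \<Rightarrow> 'b"
        by (intro image_cong refl im)
      have U: "\<Union>(insert b P) = \<Union>P \<union> b" by auto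
      have E: "restrict h (\<Union>P) \<in> ?E \<longleftrightarrow> inj_on h (\<Union>P) \<and> (\<forall>c\<in>P. h ` c \<in> orbits G S)"
          "restrict h b \<in> inj_funs b S \<longleftrightarrow> inj_on h b"
        if "h \<in> (\<Union>P \<union> b) \<rightarrow>\<^sub>E S" for h
        using that by (auto simp: inj_funs_def inj_on_restrict_eq im cong del: image_cong_simp)
      have "h \<in> ?L \<longleftrightarrow> h \<in> ?R" for h
      proof (cases "h \<in> (\<Union>P \<union> b) \<rightarrow>\<^sub>E S \<and> h ` b \<in> orbits G S \<and> (\<forall>c\<in>P. h ` c \<in> orbits G S)")
        case False
        have "h \<notin> ?L"
        proof
          assume "h \<in> ?L"
          then have "h \<in> inj_funs (\<Union>P \<union> b) S \<and> (\<forall>c\<in>insert b P. h ` c \<in> orbits G S)"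
            unfolding U by (rule CollectD)
          then show False using False unfolding inj_funs_def by blast
        qed
        moreover have "h \<notin> ?R"
        proof
          assume "h \<in> ?R"
          note R = this[THEN CollectD]
          have h: "h \<in> (\<Union>P \<union> b) \<rightarrow>\<^sub>E S" by (rule R[THEN conjunct1])
          have "\<forall>c\<in>P. h ` c \<in> orbits G S"
            by (rule E(1)[OF h, THEN iffD1, THEN conjunct2]) (rule R[THEN conjunct2, THEN conjunct1])
          moreover have "h ` b \<in> orbits G S"
            using R[THEN conjunct2, THEN conjunct2, THEN conjunct2, THEN DiffD1, THEN CollectD, THEN conjunct1]
            by (simp only: imb)
          ultimately show False using False h by (elim notE) (intro conjI)
        qed
        ultimately show ?thesis by (simp only:)
      next
        case True
        have "(\<forall>c\<in>P. h ` c \<inter> h ` b = {}) \<longleftrightarrow> (\<forall>c\<in>P. h ` c \<noteq> h ` b)"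
          by (intro ball_cong refl, rule orb) (use True in \<open>simp_all\<close>)
        then have disj: "(\<forall>c\<in>P. h ` c \<inter> h ` b = {}) \<longleftrightarrow> h ` b \<notin> (\<lambda>c. h ` c) ` P"
          by (simp add: image_iff eq_commute)
        have "h \<in> ?L \<longleftrightarrow> inj_on h (\<Union>P \<union> b)" unfolding U using True by (auto simp: inj_funs_def)
        also have "\<dots> \<longleftrightarrow> inj_on h (\<Union>P) \<and> inj_on h b \<and> h ` b \<notin> (\<lambda>c. h ` c) ` P"
          by (simp only: inj disj)
        also have "\<dots> \<longleftrightarrow> h \<in> ?R" using True E[of h] card_image[of h b] by (auto simp: imb ims cong del: image_cong_simp)
        finally show ?thesis .
      qed
      then show ?thesis by blast
    qed
    have count: "card {g \<in> b \<rightarrow>\<^sub>E S. f \<in> ?E \<and> g \<in> inj_funs b S \<and>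
        g ` b \<in> {Q \<in> orbits G S. card Q = ?i} - (\<lambda>c. f ` c) ` P} = 
        (if f \<in> ?E then (num_orbits_of_size G S ?i - ?m ?i) * fact ?i else 0)" for f
    proof (cases "f \<in> ?E")
      case False
      then show ?thesis by (simp only: if_False simp_thms empty_def[symmetric] card.empty)
    next
      case True
      let ?QQ = "{Q \<in> orbits G S. card Q = ?i} - (\<lambda>c. f ` c) ` P"
      \<comment> \<open>Blocks of other sizes occupy orbits of other sizes and remove no
        candidate.\<close>
      have "card ?QQ = card ({Q \<in> orbits G S. card Q = ?i} - (\<lambda>c. f ` c) ` {c \<in> P. card c = ?i})"
      proof -
        have "card (f ` c) = card c" if "c \<in> P" for c
          using True that by (intro card_image) (auto simp: inj_funs_def intro: inj_on_subset)
        then have "?QQ = {Q \<in> orbits G S. card Q = ?i} - (\<lambda>c. f ` c) ` {c \<in> P. card c = ?i}" by auto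
        then show ?thesis by (simp only:)
      qed
      also have "\<dots> = num_orbits_of_size G S ?i - card ((\<lambda>c. f ` c) ` {c \<in> P. card c = ?i})"
        unfolding num_orbits_of_size_def
      proof (rule card_Diff_subset)
        show "finite ((\<lambda>c. f ` c) ` {c \<in> P. card c = ?i})" using insert.hyps(1) by simp
        have "card (f ` c) = card c" if "c \<in> P" for c
          using True that by (intro card_image) (auto simp: inj_funs_def intro: inj_on_subset)
        then show "(\<lambda>c. f ` c) ` {c \<in> P. card c = ?i} \<subseteq> {Q \<in> orbits G S. card Q = ?i}" using True by auto
      qed
      also have "card ((\<lambda>c. f ` c) ` {c \<in> P. card c = ?i}) = ?m ?i"
      proof (rule card_image)
        have "inj_on f (\<Union>P)" using True by (simp add: inj_funs_def)
        then have "inj_on (image f) (Pow (\<Union>P))" by (rule inj_on_image_Pow)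
        then show "inj_on (\<lambda>c. f ` c) {c \<in> P. card c = ?i}" by (rule inj_on_subset) auto
      qed
      finally have QQ: "card ?QQ = num_orbits_of_size G S ?i - ?m ?i" .
      have "card {g \<in> b \<rightarrow>\<^sub>E S. f \<in> ?E \<and> g \<in> inj_funs b S \<and> g ` b \<in> ?QQ} = card {g \<in> inj_funs b S. g ` b \<in> ?QQ}"
        using True by (intro arg_cong[where f = card]) (auto simp: inj_funs_def)
      also have "\<dots> = card ?QQ * fact ?i"
        using B(4) S orbits_iff[OF G] by (intro card_inj_funs_onto) auto
      finally show ?thesis using True by (simp only: if_True QQ)
    qed
    have le: "?m ?i \<le> num_orbits_of_size G S ?i" if f: "f \<in> ?E" for f
    proof -
      have inj: "inj_on f (\<Union>P)" using f by (simp add: inj_funs_def)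
      have "card (f ` c) = card c" if "c \<in> P" for c
        using inj that by (intro card_image) (auto intro: inj_on_subset)
      then have "(\<lambda>c. f ` c) ` {c \<in> P. card c = ?i} \<subseteq> {Q \<in> orbits G S. card Q = ?i}" using f by auto
      moreover have "inj_on (\<lambda>c. f ` c) {c \<in> P. card c = ?i}"
        by (rule inj_on_subset[OF inj_on_image_Pow[OF inj]]) auto
      ultimately show ?thesis
        unfolding num_orbits_of_size_def by (intro card_inj_on_le) (auto simp: finite_orbits S)
    qed
    have "card ?L = card ?R" by (subst 1) (rule refl)
    also have "\<dots> = (\<Sum>f\<in>\<Union>P \<rightarrow>\<^sub>E S. card {g \<in> b \<rightarrow>\<^sub>E S. f \<in> ?E \<and> g \<in> inj_funs b S \<and>
        g ` b \<in> {Q \<in> orbits G S. card Q = ?i} - (\<lambda>c. f ` c) ` P})"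
      using B S by (intro card_funcset_split) auto
    also have "\<dots> = (\<Sum>f\<in>\<Union>P \<rightarrow>\<^sub>E S. if f \<in> ?E then (num_orbits_of_size G S ?i - ?m ?i) * fact ?i else 0)"
      by (intro sum.cong refl count)
    also have "\<dots> = card ((\<Union>P \<rightarrow>\<^sub>E S) \<inter> ?E) * ((num_orbits_of_size G S ?i - ?m ?i) * fact ?i)"
      using B(3) S by (subst sum.If_cases) (auto intro: finite_PiE simp: Int_def)
    also have "(\<Union>P \<rightarrow>\<^sub>E S) \<inter> ?E = ?E" by (auto simp: inj_funs_def)
    finally have "real (card ?L) = real (card ?E) * (real (num_orbits_of_size G S ?i - ?m ?i) * fact ?i)"
      by simp
    \<comment> \<open>The truncated difference must agree with the real one in
      \<open>falling\<close>. If an embedding of the old blocks exists, enough orbits exist and the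
      two agree; if none exists, both sides are 0.\<close>
    also have "\<dots> = real (card ?E) * ((?N ?i - real (?m ?i)) * fact ?i)"
    proof (cases "?E = {}")
      case True
      then have "card ?E = 0" by (metis card.empty)
      then show ?thesis by (simp only: of_nat_0 mult_zero_left)
    next
      case False
      then have "?m ?i \<le> num_orbits_of_size G S ?i" using le by blast
      then show ?thesis by (simp only: of_nat_diff)
    qed
    also have "real (card ?E) = (\<Prod>i\<in>I. falling (?N i) (?m i) * fact i ^ ?m i)"
      using insert.prems(2) by (intro insert.IH[OF B(1)]) auto
    also have "\<dots> = falling (?N ?i) (?m ?i) * fact ?i ^ ?m ?i *
        (\<Prod>i\<in>I - {?i}. falling (?N i) (?m i) * fact i ^ ?m i)"
      by (rule prod.remove[OF I(1) i])
    finally have L: "real (card ?L) = falling (?N ?i) (Suc (?m ?i)) * fact ?i ^ Suc (?m ?i) *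
        (\<Prod>i\<in>I - {?i}. falling (?N i) (?m i) * fact i ^ ?m i)"
      by (simp only: falling_Suc power_Suc mult_ac)
    have m1: "card {c \<in> insert b P. card c = ?i} = Suc (?m ?i)"
    proof -
      have "{c \<in> insert b P. card c = ?i} = insert b {c \<in> P. card c = ?i}" by auto
      then show ?thesis using insert.hyps by simp
    qed
    have m2: "card {c \<in> insert b P. card c = i} = ?m i" if "i \<noteq> ?i" for i
      using that by (intro arg_cong[where f = card]) auto
    have "(\<Prod>i\<in>I. falling (?N i) (card {c \<in> insert b P. card c = i}) * fact i ^ card {c \<in> insert b P. card c = i}) =
        falling (?N ?i) (Suc (?m ?i)) * fact ?i ^ Suc (?m ?i) *
        (\<Prod>i\<in>I - {?i}. falling (?N i) (card {c \<in> insert b P. card c = i}) * fact i ^ card {c \<in> insert b P. card c = i})"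
      by (subst prod.remove[OF I(1) i]) (simp only: m1)
    also have "(\<Prod>i\<in>I - {?i}. falling (?N i) (card {c \<in> insert b P. card c = i}) * fact i ^ card {c \<in> insert b P. card c = i}) =
        (\<Prod>i\<in>I - {?i}. falling (?N i) (?m i) * fact i ^ ?m i)"
      by (intro prod.cong refl) (simp only: m2 Diff_iff singleton_iff simp_thms)
    finally show ?case using L by (simp only:)
  qed
qed

section \<open>Counting block-wise stable embeddings\<close>

text \<open>The part of \<open>glued\<close> that a single permutation can see, together with
  injectivity on the block. Minimality is dropped, as it couples the two permutations and upper
  bounds can do without it.\<close>

definition stable_emb :: "('b \<Rightarrow> 'b) \<Rightarrow> 'a set \<Rightarrow> ('a \<Rightarrow> 'b) \<Rightarrow> bool" where
  "stable_emb \<pi> b f \<longleftrightarrow> inj_on f b \<and> \<pi> ` f ` b = f ` b"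

lemma stable_emb_cong:
  assumes "\<And>x. x \<in> b \<Longrightarrow> f x = g x" shows "stable_emb \<pi> b f = stable_emb \<pi> b g"
proof -
  have "f ` b = g ` b" using assms by (auto intro!: image_cong)
  moreover have "inj_on f b = inj_on g b" using assms by (rule inj_on_cong)
  ultimately show ?thesis by (simp add: stable_emb_def)
qed

text \<open>The number of maps with a given image is bounded by all maps into it, card b to the
  power card b: any factor depending only on M may be spent.\<close>

lemma card_funs_image_le:
  assumes "finite b" "finite T" "\<And>Q. Q \<in> T \<Longrightarrow> finite Q \<and> card Q = card b"
    and "\<And>f. f \<in> X \<Longrightarrow> f \<in> b \<rightarrow>\<^sub>E S \<and> f ` b \<in> T"
  shows "real (card X) \<le> real (card T) * real (card b) ^ card b"
proof -
  have "X \<subseteq> (\<Union>Q\<in>T. b \<rightarrow>\<^sub>E Q)"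
  proof
    fix f assume "f \<in> X"
    then have "f ` b \<in> T" "f \<in> b \<rightarrow>\<^sub>E f ` b" using assms(4)[of f] by (auto simp: PiE_def)
    then show "f \<in> (\<Union>Q\<in>T. b \<rightarrow>\<^sub>E Q)" by blast
  qed
  moreover have "finite (\<Union>Q\<in>T. b \<rightarrow>\<^sub>E Q)" using assms(1-3) by (auto intro!: finite_PiE)
  ultimately have "card X \<le> card (\<Union>Q\<in>T. b \<rightarrow>\<^sub>E Q)" by (intro card_mono)
  also have "\<dots> \<le> (\<Sum>Q\<in>T. card (b \<rightarrow>\<^sub>E Q))" using assms(2) by (rule card_UN_le)
  also have "\<dots> = (\<Sum>Q\<in>T. card b ^ card b)"
    using assms(1,3) by (intro sum.cong refl) (simp add: card_funcsetE)
  also have "\<dots> = card T * card b ^ card b" by simp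
  finally have "real (card X) \<le> real (card T * card b ^ card b)" by (simp only: of_nat_le_iff)
  then show ?thesis by simp
qed

lemma stable_emb_image:
  assumes "f \<in> b \<rightarrow>\<^sub>E {1..n}" "stable_emb \<pi> b f"
  shows "f ` b \<in> stable_sets n \<pi> (card b)"
  using assms by (auto simp: stable_sets_def stable_emb_def card_image)

lemma stable_sets_finite_member: "Q \<in> stable_sets n \<pi> a \<Longrightarrow> finite Q \<and> card Q = a"
  unfolding stable_sets_def using finite_subset[of Q "{1..n}"] by auto

text \<open>Replacing \<open>card b\<close> by the common \<open>M\<close> in the base yields a pure
  power with exponent \<open>card b\<close>, and such bounds multiply over the blocks to an exponent
  equal to the total size.\<close>

lemma weight_power_bound:
  assumes "card b \<le> M" "(0::real) \<le> F"
  shows "(2 * F) ^ card b * real (card b) ^ card b \<le> (2 * real M * F) ^ card b"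
proof -
  have "(2 * F) ^ card b * real (card b) ^ card b \<le> (2 * F) ^ card b * real M ^ card b"
    using assms by (intro mult_left_mono power_mono) auto
  also have "\<dots> = (2 * F * real M) ^ card b" by (simp only: power_mult_distrib)
  also have "\<dots> = (2 * real M * F) ^ card b" by (simp only: mult_ac)
  finally show ?thesis .
qed

lemma card_stable_emb_le:
  assumes \<pi>: "\<pi> permutes {1..n}" and n: "1 \<le> n" and b: "finite b" "card b \<le> M"
  shows "real (card {f \<in> b \<rightarrow>\<^sub>E {1..n}. stable_emb \<pi> b f}) \<le> (2 * real M * cycle_weight n \<pi>) ^ card b"
proof -
  have "real (card {f \<in> b \<rightarrow>\<^sub>E {1..n}. stable_emb \<pi> b f}) \<le>
      real (card (stable_sets n \<pi> (card b))) * real (card b) ^ card b"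
  proof (rule card_funs_image_le[where S = "{1..n}"])
    show "finite Q \<and> card Q = card b" if "Q \<in> stable_sets n \<pi> (card b)" for Q
      using that by (rule stable_sets_finite_member)
    show "f \<in> b \<rightarrow>\<^sub>E {1..n} \<and> f ` b \<in> stable_sets n \<pi> (card b)"
      if "f \<in> {f \<in> b \<rightarrow>\<^sub>E {1..n}. stable_emb \<pi> b f}" for f
      using that stable_emb_image[of f b n \<pi>] by blast
  qed (use b in auto)
  also have "\<dots> \<le> (2 * cycle_weight n \<pi>) ^ card b * real (card b) ^ card b"
    by (rule mult_right_mono[OF card_stable_sets_le[OF \<pi> n]]) simp
  also have "\<dots> \<le> (2 * real M * cycle_weight n \<pi>) ^ card b"
    by (rule weight_power_bound) (use b(2) cycle_weight_ge_1[OF \<pi> n] in auto)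
  finally show ?thesis .
qed

text \<open>A prescribed value forces the image to contain the point z, so the count of stable sets
  through z applies and saves a factor of the weight.\<close>

lemma card_stable_emb_pinned_le:
  assumes \<pi>: "\<pi> permutes {1..n}" and n: "1 \<le> n" and b: "finite b" "card b \<le> M" and y: "y \<in> b"
  shows "real (card {f \<in> b \<rightarrow>\<^sub>E {1..n}. stable_emb \<pi> b f \<and> f y = z}) \<le>
    (2 * real M * cycle_weight n \<pi>) ^ card b / cycle_weight n \<pi>"
proof -
  let ?F = "cycle_weight n \<pi>" and ?T = "{Q \<in> stable_sets n \<pi> (card b). z \<in> Q}"
  have F: "1 \<le> ?F" by (rule cycle_weight_ge_1[OF \<pi> n])
  have "real (card {f \<in> b \<rightarrow>\<^sub>E {1..n}. stable_emb \<pi> b f \<and> f y = z}) \<le> real (card ?T) * real (card b) ^ card b"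
  proof (rule card_funs_image_le[where S = "{1..n}"])
    show "finite Q \<and> card Q = card b" if "Q \<in> ?T" for Q
      using that stable_sets_finite_member by blast
    show "f \<in> b \<rightarrow>\<^sub>E {1..n} \<and> f ` b \<in> ?T" if "f \<in> {f \<in> b \<rightarrow>\<^sub>E {1..n}. stable_emb \<pi> b f \<and> f y = z}" for f
      using that stable_emb_image[of f b n \<pi>] y by auto
  qed (use b in auto)
  also have "\<dots> \<le> (2 * ?F) ^ card b / ?F * real (card b) ^ card b"
    by (rule mult_right_mono[OF card_stable_sets_containing_le[OF \<pi> n]]) simp
  also have "\<dots> = ((2 * ?F) ^ card b * real (card b) ^ card b) / ?F" by (rule times_divide_eq_left)
  also have "\<dots> \<le> (2 * real M * ?F) ^ card b / ?F"
    by (rule divide_right_mono[OF weight_power_bound]) (use b(2) F in auto)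
  finally show ?thesis .
qed

definition stable_block_embs :: "nat \<Rightarrow> (nat \<Rightarrow> nat) \<Rightarrow> 'a set set \<Rightarrow> ('a \<Rightarrow> nat) set" where
  "stable_block_embs n \<pi> P = {f \<in> \<Union>P \<rightarrow>\<^sub>E {1..n}. \<forall>b\<in>P. stable_emb \<pi> b f}"

lemma finite_stable_block_embs: "finite (\<Union>P) \<Longrightarrow> finite (stable_block_embs n \<pi> P)"
  unfolding stable_block_embs_def by (rule finite_subset[of _ "\<Union>P \<rightarrow>\<^sub>E {1..n}"]) (auto intro: finite_PiE)

lemma card_stable_block_embs_le:
  assumes \<pi>: "\<pi> permutes {1..n}" and n: "1 \<le> n" and P: "blocks P" "\<And>b. b \<in> P \<Longrightarrow> card b \<le> M"
  shows "real (card (stable_block_embs n \<pi> P)) \<le> (2 * real M * cycle_weight n \<pi>) ^ card (\<Union>P)"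
proof -
  have "card (stable_block_embs n \<pi> P) = (\<Prod>b\<in>P. card {f \<in> b \<rightarrow>\<^sub>E {1..n}. stable_emb \<pi> b f})"
    unfolding stable_block_embs_def by (rule card_funcset_blocks[OF P(1)], simp, rule stable_emb_cong) auto
  then have "real (card (stable_block_embs n \<pi> P)) =
      (\<Prod>b\<in>P. real (card {f \<in> b \<rightarrow>\<^sub>E {1..n}. stable_emb \<pi> b f}))" by simp
  also have "\<dots> \<le> (\<Prod>b\<in>P. (2 * real M * cycle_weight n \<pi>) ^ card b)"
    using P by (intro prod_mono conjI card_stable_emb_le[OF \<pi> n]) (auto simp: blocks_def)
  also have "\<dots> = (2 * real M * cycle_weight n \<pi>) ^ card (\<Union>P)"
    by (simp add: blocks_card_Union[OF P(1)] power_sum)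
  finally show ?thesis .
qed

lemma card_le_card_Union:
  assumes "blocks P" "b \<in> P" shows "card b \<le> card (\<Union>P)"
  using assms by (intro card_mono blocks_finite_Union) auto

text \<open>A coincidence between two blocks pins one value of the embedding of the second block, which
  saves a factor of the cycle weight.\<close>

lemma card_coincidence_le:
  assumes \<pi>: "\<pi> permutes {1..n}" and n: "1 \<le> n" and P: "blocks P" and y: "y \<in> \<Union>P" and x: "x \<in> \<Union>P"
  shows "real (card {f \<in> stable_block_embs n \<pi> P. x \<noteq> y \<and> f x = f y}) \<le>
    (2 * real (card (\<Union>P)) * cycle_weight n \<pi>) ^ card (\<Union>P) / cycle_weight n \<pi>"
proof -
  let ?F = "cycle_weight n \<pi>" and ?M = "card (\<Union>P)" and ?X = "{f \<in> stable_block_embs n \<pi> P. x \<noteq> y \<and> f x = f y}"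
  let ?K = "2 * real ?M * ?F"
  have F: "1 \<le> ?F" by (rule cycle_weight_ge_1[OF \<pi> n])
  obtain b where b: "b \<in> P" "y \<in> b" using y by blast
  define P' where "P' = P - {b}"
  have PP': "P = insert b P'" "b \<notin> P'" using b by (auto simp: P'_def)
  note B = blocks_insertD[OF P[unfolded PP'(1)] PP'(2)]
  show ?thesis
  proof (cases "x \<in> b")
    case True
    have "?X = {}"
    proof (intro equals0I)
      fix f assume f: "f \<in> ?X"
      then have "inj_on f b" using b by (auto simp: stable_block_embs_def stable_emb_def)
      then show False using f True b(2) by (auto dest: inj_onD)
    qed
    then have "card ?X = 0" by (metis card.empty)
    then have "real (card ?X) = 0" by (simp only: of_nat_0)
    also have "0 \<le> ?K ^ ?M / ?F" using F by (intro divide_nonneg_nonneg zero_le_power mult_nonneg_nonneg) auto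
    finally show ?thesis .
  next
    case False
    then have x': "x \<in> \<Union>P'" using x PP' by auto
    \<comment> \<open>Once f is fixed on the other blocks, the coincidence prescribes the value of g
      at y.\<close>
    define R where "R f g \<longleftrightarrow> (\<forall>c\<in>P'. stable_emb \<pi> c f) \<and> stable_emb \<pi> b g \<and> g y = f x" for f g
    have sub: "?X \<subseteq> {h \<in> (\<Union>P' \<union> b) \<rightarrow>\<^sub>E {1..n}. R (restrict h (\<Union>P')) (restrict h b)}"
    proof
      fix h assume h: "h \<in> ?X"
      have "stable_emb \<pi> c (restrict h (\<Union>P'))" if "c \<in> P'" for c
      proof -
        have "stable_emb \<pi> c (restrict h (\<Union>P')) = stable_emb \<pi> c h" by (rule stable_emb_cong) (use that in auto)
        then show ?thesis using h that PP' by (auto simp: stable_block_embs_def)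
      qed
      moreover have "stable_emb \<pi> b (restrict h b)"
      proof -
        have "stable_emb \<pi> b (restrict h b) = stable_emb \<pi> b h" by (rule stable_emb_cong) auto
        then show ?thesis using h b(1) by (auto simp: stable_block_embs_def)
      qed
      moreover have "restrict h b y = restrict h (\<Union>P') x" using h x' b(2) by auto
      moreover have "\<Union>P' \<union> b = \<Union>P" using PP' by auto
      ultimately show "h \<in> {h \<in> (\<Union>P' \<union> b) \<rightarrow>\<^sub>E {1..n}. R (restrict h (\<Union>P')) (restrict h b)}"
        using h unfolding R_def stable_block_embs_def by (simp only:) simp
    qed
    have fin: "finite {h \<in> (\<Union>P' \<union> b) \<rightarrow>\<^sub>E {1..n}. R (restrict h (\<Union>P')) (restrict h b)}"
      by (rule finite_subset[of _ "(\<Union>P' \<union> b) \<rightarrow>\<^sub>E {1..n}"], blast) (use B in \<open>simp add: finite_PiE\<close>)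
    have M: "card b \<le> ?M" by (rule card_le_card_Union[OF P b(1)])
    have cU: "card (\<Union>P') + card b = ?M"
      using B PP' by (simp add: card_Un_disjoint[symmetric] Un_commute Int_commute)
    have "real (card ?X) \<le> real (card {h \<in> (\<Union>P' \<union> b) \<rightarrow>\<^sub>E {1..n}. R (restrict h (\<Union>P')) (restrict h b)})"
      using card_mono[OF fin sub] by simp
    also have "\<dots> = (\<Sum>f\<in>\<Union>P' \<rightarrow>\<^sub>E {1..n}. real (card {g \<in> b \<rightarrow>\<^sub>E {1..n}. R f g}))"
      using B by (subst card_funcset_split) auto
    also have "\<dots> \<le> (\<Sum>f\<in>\<Union>P' \<rightarrow>\<^sub>E {1..n}. if f \<in> stable_block_embs n \<pi> P' then ?K ^ card b / ?F else 0)"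
    proof (rule sum_mono)
      fix f assume f: "f \<in> \<Union>P' \<rightarrow>\<^sub>E {1..n}"
      show "real (card {g \<in> b \<rightarrow>\<^sub>E {1..n}. R f g}) \<le> (if f \<in> stable_block_embs n \<pi> P' then ?K ^ card b / ?F else 0)"
      proof (cases "\<forall>c\<in>P'. stable_emb \<pi> c f")
        case True
        then have "{g \<in> b \<rightarrow>\<^sub>E {1..n}. R f g} = {g \<in> b \<rightarrow>\<^sub>E {1..n}. stable_emb \<pi> b g \<and> g y = f x}"
          by (auto simp: R_def)
        moreover have "f \<in> stable_block_embs n \<pi> P'" using f True by (simp add: stable_block_embs_def)
        ultimately show ?thesis
          using card_stable_emb_pinned_le[OF \<pi> n B(4) M b(2), of "f x"] by (simp only: if_True)
      next
        case False
        then have "{g \<in> b \<rightarrow>\<^sub>E {1..n}. R f g} = {}" by (auto simp: R_def)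
        then have "card {g \<in> b \<rightarrow>\<^sub>E {1..n}. R f g} = 0" by (metis card.empty)
        then show ?thesis using F by (simp only: of_nat_0) simp
      qed
    qed
    also have "\<dots> = real (card (stable_block_embs n \<pi> P')) * (?K ^ card b / ?F)"
    proof -
      have "(\<Union>P' \<rightarrow>\<^sub>E {1..n}) \<inter> {f. f \<in> stable_block_embs n \<pi> P'} = stable_block_embs n \<pi> P'"
        by (auto simp: stable_block_embs_def)
      then show ?thesis using B(3) by (simp add: sum.If_cases finite_PiE)
    qed
    also have "\<dots> \<le> ?K ^ card (\<Union>P') * (?K ^ card b / ?F)"
    proof (rule mult_right_mono)
      show "real (card (stable_block_embs n \<pi> P')) \<le> ?K ^ card (\<Union>P')"
        using card_le_card_Union[OF P] PP' by (intro card_stable_block_embs_le[OF \<pi> n B(1)]) auto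
    qed (use F in \<open>intro divide_nonneg_nonneg zero_le_power mult_nonneg_nonneg; simp\<close>)
    also have "\<dots> = ?K ^ ?M / ?F" by (simp add: power_add flip: cU)
    finally show ?thesis .
  qed
qed

text \<open>Union bound over the at most M^2 pairs of points that could collide.\<close>

lemma card_noninjective_le:
  assumes \<pi>: "\<pi> permutes {1..n}" and n: "1 \<le> n" and P: "blocks P"
  shows "real (card {f \<in> stable_block_embs n \<pi> P. \<not> inj_on f (\<Union>P)}) \<le>
    real (card (\<Union>P)) ^ 2 * (2 * real (card (\<Union>P)) * cycle_weight n \<pi>) ^ card (\<Union>P) / cycle_weight n \<pi>"
proof -
  let ?A = "\<Union>P" and ?X = "\<lambda>(x, y). {f \<in> stable_block_embs n \<pi> P. x \<noteq> y \<and> f x = f y}"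
  have fin: "finite ?A" by (rule blocks_finite_Union[OF P])
  have "{f \<in> stable_block_embs n \<pi> P. \<not> inj_on f ?A} \<subseteq> (\<Union>p\<in>?A \<times> ?A. ?X p)"
    unfolding inj_on_def by blast
  moreover have "finite (\<Union>p\<in>?A \<times> ?A. ?X p)" using fin by (auto simp: finite_stable_block_embs)
  ultimately have "card {f \<in> stable_block_embs n \<pi> P. \<not> inj_on f ?A} \<le> card (\<Union>p\<in>?A \<times> ?A. ?X p)"
    by (intro card_mono)
  also have "\<dots> \<le> (\<Sum>p\<in>?A \<times> ?A. card (?X p))" using fin by (intro card_UN_le) auto
  finally have "real (card {f \<in> stable_block_embs n \<pi> P. \<not> inj_on f ?A}) \<le> (\<Sum>p\<in>?A \<times> ?A. real (card (?X p)))"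
    by (simp only: of_nat_sum[symmetric] of_nat_le_iff)
  also have "\<dots> \<le> (\<Sum>p\<in>?A \<times> ?A. (2 * real (card ?A) * cycle_weight n \<pi>) ^ card ?A / cycle_weight n \<pi>)"
    using card_coincidence_le[OF \<pi> n P] by (intro sum_mono) auto
  finally show ?thesis by (simp add: card_cartesian_product power2_eq_square)
qed

section \<open>Pairs of embeddings\<close>

text \<open>A pair of maps into S is one map into S \<times> S, so the product formula for blocks
  also applies to pairs.\<close>

lemma card_fun_pairs:
  assumes "\<And>f g f' g'. (\<And>x. x \<in> A \<Longrightarrow> f x = f' x) \<Longrightarrow> (\<And>x. x \<in> A \<Longrightarrow> g x = g' x) \<Longrightarrow> R f g = R f' g'"
  shows "card {(f, g). f \<in> A \<rightarrow>\<^sub>E S \<and> g \<in> A \<rightarrow>\<^sub>E S \<and> R f g} = card {h \<in> A \<rightarrow>\<^sub>E S \<times> S. R (fst \<circ> h) (snd \<circ> h)}"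
proof -
  have "bij_betw (\<lambda>(f, g). \<lambda>x\<in>A. (f x, g x)) {(f, g). f \<in> A \<rightarrow>\<^sub>E S \<and> g \<in> A \<rightarrow>\<^sub>E S \<and> R f g}
      {h \<in> A \<rightarrow>\<^sub>E S \<times> S. R (fst \<circ> h) (snd \<circ> h)}"
  proof (rule bij_betw_byWitness[where f' = "\<lambda>h. (restrict (fst \<circ> h) A, restrict (snd \<circ> h) A)"])
    show "\<forall>p\<in>{(f, g). f \<in> A \<rightarrow>\<^sub>E S \<and> g \<in> A \<rightarrow>\<^sub>E S \<and> R f g}.
        (restrict (fst \<circ> (case p of (f, g) \<Rightarrow> \<lambda>x\<in>A. (f x, g x))) A,
         restrict (snd \<circ> (case p of (f, g) \<Rightarrow> \<lambda>x\<in>A. (f x, g x))) A) = p"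
      by (auto simp: fun_eq_iff PiE_def extensional_def)
    show "\<forall>h\<in>{h \<in> A \<rightarrow>\<^sub>E S \<times> S. R (fst \<circ> h) (snd \<circ> h)}.
        (case (restrict (fst \<circ> h) A, restrict (snd \<circ> h) A) of (f, g) \<Rightarrow> \<lambda>x\<in>A. (f x, g x)) = h"
      by (auto simp: fun_eq_iff PiE_def extensional_def)
    show "(\<lambda>(f, g). \<lambda>x\<in>A. (f x, g x)) ` {(f, g). f \<in> A \<rightarrow>\<^sub>E S \<and> g \<in> A \<rightarrow>\<^sub>E S \<and> R f g}
        \<subseteq> {h \<in> A \<rightarrow>\<^sub>E S \<times> S. R (fst \<circ> h) (snd \<circ> h)}"
    proof (rule image_subsetI, clarify)
      fix f g assume fg: "f \<in> A \<rightarrow>\<^sub>E S" "g \<in> A \<rightarrow>\<^sub>E S" "R f g"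
      have "R (fst \<circ> (\<lambda>x\<in>A. (f x, g x))) (snd \<circ> (\<lambda>x\<in>A. (f x, g x))) = R f g" by (rule assms) auto
      then show "(\<lambda>x\<in>A. (f x, g x)) \<in> A \<rightarrow>\<^sub>E S \<times> S \<and>
          R (fst \<circ> (\<lambda>x\<in>A. (f x, g x))) (snd \<circ> (\<lambda>x\<in>A. (f x, g x)))"
        using fg by auto
    qed
    show "(\<lambda>h. (restrict (fst \<circ> h) A, restrict (snd \<circ> h) A)) ` {h \<in> A \<rightarrow>\<^sub>E S \<times> S. R (fst \<circ> h) (snd \<circ> h)}
        \<subseteq> {(f, g). f \<in> A \<rightarrow>\<^sub>E S \<and> g \<in> A \<rightarrow>\<^sub>E S \<and> R f g}"
    proof (rule image_subsetI, clarify)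
      fix h assume h: "h \<in> A \<rightarrow>\<^sub>E S \<times> S" "R (fst \<circ> h) (snd \<circ> h)"
      have "R (restrict (fst \<circ> h) A) (restrict (snd \<circ> h) A) = R (fst \<circ> h) (snd \<circ> h)" by (rule assms) auto
      moreover have "fst (h x) \<in> S \<and> snd (h x) \<in> S" if "x \<in> A" for x
        using PiE_mem[OF h(1) that] by (simp add: mem_Times_iff)
      ultimately show "restrict (fst \<circ> h) A \<in> A \<rightarrow>\<^sub>E S \<and> restrict (snd \<circ> h) A \<in> A \<rightarrow>\<^sub>E S \<and>
          R (restrict (fst \<circ> h) A) (restrict (snd \<circ> h) A)"
        using h(2) by auto
    qed
  qed
  then show ?thesis by (rule bij_betw_same_card)
qed

definition glued_pairs :: "nat \<Rightarrow> (nat \<Rightarrow> nat) \<Rightarrow> (nat \<Rightarrow> nat) \<Rightarrow> 'a set set \<Rightarrow> (('a \<Rightarrow> nat) \<times> ('a \<Rightarrow> nat)) set" where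
  "glued_pairs n \<pi> \<pi>' P = {(f, g). f \<in> inj_funs (\<Union>P) {1..n} \<and> g \<in> inj_funs (\<Union>P) {1..n} \<and>
      (\<forall>b\<in>P. glued \<pi> \<pi>' b f g)}"

definition glued_block_pairs :: "nat \<Rightarrow> (nat \<Rightarrow> nat) \<Rightarrow> (nat \<Rightarrow> nat) \<Rightarrow> 'a set set \<Rightarrow> (('a \<Rightarrow> nat) \<times> ('a \<Rightarrow> nat)) set" where
  "glued_block_pairs n \<pi> \<pi>' P = {(f, g). f \<in> \<Union>P \<rightarrow>\<^sub>E {1..n} \<and> g \<in> \<Union>P \<rightarrow>\<^sub>E {1..n} \<and>
      (\<forall>b\<in>P. inj_on f b \<and> inj_on g b \<and> glued \<pi> \<pi>' b f g)}"

lemma card_glued_block_pairs: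
  assumes P: "blocks P"
  shows "card (glued_block_pairs n \<pi> \<pi>' P) = (\<Prod>b\<in>P. card (glued_pairs n \<pi> \<pi>' {b}))"
proof -
  define R where "R b f g \<longleftrightarrow> inj_on f b \<and> inj_on g b \<and> glued \<pi> \<pi>' b f g" for b :: "'a set" and f g :: "'a \<Rightarrow> nat"
  have R: "R b f g = R b f' g'" if "\<And>x. x \<in> b \<Longrightarrow> f x = f' x" "\<And>x. x \<in> b \<Longrightarrow> g x = g' x" for b f f' g g'
    unfolding R_def using glued_cong[of b f f' g g', OF that] inj_on_cong[of b f f', OF that(1)]
      inj_on_cong[of b g g', OF that(2)] by simp
  have "card (glued_block_pairs n \<pi> \<pi>' P) =
      card {(f, g). f \<in> \<Union>P \<rightarrow>\<^sub>E {1..n} \<and> g \<in> \<Union>P \<rightarrow>\<^sub>E {1..n} \<and> (\<forall>b\<in>P. R b f g)}"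
    by (simp add: glued_block_pairs_def R_def)
  also have "\<dots> = card {h \<in> \<Union>P \<rightarrow>\<^sub>E {1..n} \<times> {1..n}. \<forall>b\<in>P. R b (fst \<circ> h) (snd \<circ> h)}"
    by (rule card_fun_pairs, intro ball_cong refl, rule R) auto
  also have "\<dots> = (\<Prod>b\<in>P. card {h \<in> b \<rightarrow>\<^sub>E {1..n} \<times> {1..n}. R b (fst \<circ> h) (snd \<circ> h)})"
    by (rule card_funcset_blocks[OF P], simp, rule R) auto
  also have "\<dots> = (\<Prod>b\<in>P. card {(f, g). f \<in> b \<rightarrow>\<^sub>E {1..n} \<and> g \<in> b \<rightarrow>\<^sub>E {1..n} \<and> R b f g})"
    by (intro prod.cong refl card_fun_pairs[symmetric] R)
  \<comment> \<open>For a single block, injectivity on the block and on the union are the same, so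
    each factor is the numerator of a mean.\<close>
  also have "\<dots> = (\<Prod>b\<in>P. card (glued_pairs n \<pi> \<pi>' {b}))"
    by (intro prod.cong refl arg_cong[where f = card]) (auto simp: glued_pairs_def inj_funs_def R_def)
  finally show ?thesis .
qed

lemma glued_pairs_subset: "glued_pairs n \<pi> \<pi>' P \<subseteq> glued_block_pairs n \<pi> \<pi>' P"
  by (auto simp: glued_pairs_def glued_block_pairs_def inj_funs_def intro: inj_on_subset)

lemma glued_block_pairs_subset:
  "glued_block_pairs n \<pi> \<pi>' P \<subseteq> stable_block_embs n \<pi> P \<times> stable_block_embs n \<pi>' P"
proof
  fix p assume p: "p \<in> glued_block_pairs n \<pi> \<pi>' P"
  obtain f g where fg: "p = (f, g)" by force
  have "\<forall>b\<in>P. stable_emb \<pi> b f \<and> stable_emb \<pi>' b g"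
    using p by (simp add: fg glued_block_pairs_def stable_emb_def glued_def)
  then show "p \<in> stable_block_embs n \<pi> P \<times> stable_block_embs n \<pi>' P"
    using p by (simp add: fg glued_block_pairs_def stable_block_embs_def)
qed

text \<open>Each component contributes (2 M F)^M or (2 M F')^M, whose product gives the constant (2
  M)^(2 M). In the error term the colliding component saves 1/F or 1/F', while the other one is
  counted in full.\<close>

lemma card_glued_pairs_le:
  assumes \<pi>: "\<pi> permutes {1..n}" "\<pi>' permutes {1..n}" and n: "1 \<le> n" and P: "blocks P"
  defines "M \<equiv> card (\<Union>P)" and "F \<equiv> cycle_weight n \<pi>" and "F' \<equiv> cycle_weight n \<pi>'"
  shows "card (glued_pairs n \<pi> \<pi>' P) \<le> card (glued_block_pairs n \<pi> \<pi>' P)"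
    and "real (card (glued_block_pairs n \<pi> \<pi>' P)) \<le> (2 * real M) ^ (2 * M) * (F * F') ^ M"
    and "real (card (glued_block_pairs n \<pi> \<pi>' P)) - real (card (glued_pairs n \<pi> \<pi>' P)) \<le>
      real M ^ 2 * ((2 * real M) ^ (2 * M) * (F * F') ^ M) * (1 / F + 1 / F')"
proof -
  let ?V = "stable_block_embs n \<pi> P" and ?V' = "stable_block_embs n \<pi>' P"
  let ?W = "{f \<in> ?V. \<not> inj_on f (\<Union>P)}" and ?W' = "{f \<in> ?V'. \<not> inj_on f (\<Union>P)}"
  let ?Y = "glued_pairs n \<pi> \<pi>' P" and ?Z = "glued_block_pairs n \<pi> \<pi>' P"
  have F: "1 \<le> F" "1 \<le> F'" unfolding F_def F'_def using cycle_weight_ge_1 \<pi> n by auto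
  have fU: "finite (\<Union>P)" by (rule blocks_finite_Union[OF P])
  have fV: "finite ?V" "finite ?V'" using finite_stable_block_embs[OF fU] by auto
  have fZ: "finite ?Z" by (rule finite_subset[OF glued_block_pairs_subset]) (simp add: fV)
  have fY: "finite ?Y" by (rule finite_subset[OF glued_pairs_subset fZ])
  show "card ?Y \<le> card ?Z" by (rule card_mono[OF fZ glued_pairs_subset])
  have V: "real (card ?V) \<le> (2 * real M * F) ^ M" "real (card ?V') \<le> (2 * real M * F') ^ M"
    unfolding M_def F_def F'_def using card_le_card_Union[OF P]
    by (intro card_stable_block_embs_le \<pi> n P; simp)+
  have W: "real (card ?W) \<le> real M ^ 2 * (2 * real M * F) ^ M / F"
      "real (card ?W') \<le> real M ^ 2 * (2 * real M * F') ^ M / F'"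
    unfolding M_def F_def F'_def by (intro card_noninjective_le \<pi> n P)+
  have prod: "(2 * real M * F) ^ M * (2 * real M * F') ^ M = (2 * real M) ^ (2 * M) * (F * F') ^ M"
    by (simp add: power_mult_distrib power_mult power2_eq_square mult_2 power_add mult_ac)
  have "card ?Z \<le> card ?V * card ?V'"
    unfolding card_cartesian_product[symmetric]
    by (rule card_mono[OF finite_cartesian_product[OF fV] glued_block_pairs_subset])
  then have "real (card ?Z) \<le> real (card ?V) * real (card ?V')" by (simp only: of_nat_mult[symmetric] of_nat_le_iff)
  also have "\<dots> \<le> (2 * real M * F) ^ M * (2 * real M * F') ^ M"
    using F by (intro mult_mono V) auto
  finally show "real (card ?Z) \<le> (2 * real M) ^ (2 * M) * (F * F') ^ M" by (simp only: prod)
  have "?Z \<subseteq> ?Y \<union> (?W \<times> ?V' \<union> ?V \<times> ?W')"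
  proof
    fix p assume p: "p \<in> ?Z"
    obtain f g where fg: "p = (f, g)" by force
    have V: "f \<in> ?V" "g \<in> ?V'" using subsetD[OF glued_block_pairs_subset p] by (simp_all add: fg)
    show "p \<in> ?Y \<union> (?W \<times> ?V' \<union> ?V \<times> ?W')"
    proof (cases "inj_on f (\<Union>P) \<and> inj_on g (\<Union>P)")
      case True
      then have "p \<in> ?Y" using p fg by (auto simp: glued_pairs_def glued_block_pairs_def inj_funs_def)
      then show ?thesis by blast
    next
      case False
      then show ?thesis using V fg by blast
    qed
  qed
  then have "card ?Z \<le> card (?Y \<union> (?W \<times> ?V' \<union> ?V \<times> ?W'))"
    using fY fV by (intro card_mono) auto
  also have "\<dots> \<le> card ?Y + card (?W \<times> ?V' \<union> ?V \<times> ?W')" by (rule card_Un_le)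
  also have "\<dots> \<le> card ?Y + (card (?W \<times> ?V') + card (?V \<times> ?W'))" by (intro add_left_mono card_Un_le)
  also have "\<dots> = card ?Y + (card ?W * card ?V' + card ?V * card ?W')" by (simp only: card_cartesian_product)
  finally have "real (card ?Z) \<le> real (card ?Y) + (real (card ?W) * real (card ?V') + real (card ?V) * real (card ?W'))"
    by (simp only: of_nat_mult[symmetric] of_nat_add[symmetric] of_nat_le_iff)
  also have "\<dots> \<le> real (card ?Y) + (real M ^ 2 * (2 * real M * F) ^ M / F * (2 * real M * F') ^ M +
      (2 * real M * F) ^ M * (real M ^ 2 * (2 * real M * F') ^ M / F'))"
    using F by (intro add_left_mono add_mono mult_mono V W) auto
  also have "\<dots> = real (card ?Y) + real M ^ 2 * ((2 * real M * F) ^ M * (2 * real M * F') ^ M) * (1 / F + 1 / F')"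
    by (simp add: field_simps)
  finally show "real (card ?Z) - real (card ?Y) \<le>
      real M ^ 2 * ((2 * real M) ^ (2 * M) * (F * F') ^ M) * (1 / F + 1 / F')"
    by (simp only: prod)
qed

section \<open>Comparison of the joint factorial moment with the product of means\<close>

lemma orbits_count_le:
  assumes "finite J"
  shows "(\<Sum>j\<in>J. num_orbits_of_size G {1..n} j) \<le> n"
proof -
  have "(\<Sum>j\<in>J. num_orbits_of_size G {1..n} j) = card (\<Union>j\<in>J. {Q \<in> orbits G {1..n}. card Q = j})"
    unfolding num_orbits_of_size_def
    by (rule card_UN_disjoint[symmetric]) (use assms in \<open>auto simp: finite_orbits\<close>)
  also have "\<dots> \<le> card (orbits G {1..n})" by (rule card_mono) (auto simp: finite_orbits)
  also have "\<dots> \<le> card {1..n}" unfolding orbits_def by (rule card_image_le) simp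
  finally show ?thesis by simp
qed

text \<open>Both c_1 and the square root of c are at most n. The resulting D \<le> 2 n turns errors
  of order 1/n into errors of order 1/D, and bounds D when n is small.\<close>

lemma cycle_weight_le: "cycle_weight n \<pi> \<le> 2 * real n"
proof -
  have "real (cycle_count n \<pi> 1) \<le> real n" using orbits_count_le[of "{1}" "{\<pi>}" n] by (simp add: cycle_count_def)
  moreover have "total_cycles n \<pi> \<le> n"
    unfolding total_cycles_def cycle_count_def by (rule orbits_count_le) simp
  then have "sqrt (real (total_cycles n \<pi>)) \<le> sqrt (real n)" by simp
  moreover have "sqrt (real n) \<le> real n"
    by (rule real_le_lsqrt) (simp_all add: power2_eq_square le_square flip: of_nat_mult)
  ultimately show ?thesis unfolding cycle_weight_def by linarith
qed

lemma Dconst_eq: "Dconst n \<pi> \<pi>' = min (cycle_weight n \<pi>) (cycle_weight n \<pi>')"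
  by (simp add: Dconst_def cycle_weight_def)

lemma Bconst_eq: "Bconst n \<pi> \<pi>' = max (cycle_weight n \<pi> * cycle_weight n \<pi>' / real n) 1"
  by (simp add: Bconst_def cycle_weight_def)

lemma Dconst_ge_1:
  assumes "\<pi> permutes {1..n}" "\<pi>' permutes {1..n}" "1 \<le> n"
  shows "1 \<le> Dconst n \<pi> \<pi>'"
  using assms by (simp add: Dconst_eq cycle_weight_ge_1)

lemma card_inj_funs_le: "card (inj_funs A {1..n}) \<le> n ^ card A" if "finite A"
proof -
  have "card (inj_funs A {1..n}) \<le> card (A \<rightarrow>\<^sub>E {1..n})"
    using that by (intro card_mono) (auto simp: inj_funs_def finite_PiE)
  then show ?thesis using that by (simp add: card_funcsetE)
qed

lemma card_inj_funs_ge: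
  assumes "finite A" "card A \<le> n"
  shows "real (n - card A) ^ card A \<le> real (card (inj_funs A {1..n}))"
proof -
  have "(n - card A) ^ card A = (\<Prod>i<card A. n - card A)" by simp
  also have "\<dots> \<le> (\<Prod>i<card A. n - i)" by (rule prod_mono) auto
  also have "\<dots> = card (inj_funs A {1..n})" using assms(1) by (simp add: card_inj_funs)
  finally have "real ((n - card A) ^ card A) \<le> real (card (inj_funs A {1..n}))" by (simp only: of_nat_le_iff)
  then show ?thesis by simp
qed

lemma card_inj_funs_le_prod:
  fixes n :: nat
  assumes P: "blocks P"
  shows "card (inj_funs (\<Union>P) {1..n}) \<le> (\<Prod>b\<in>P. card (inj_funs b {1..n}))"
proof -
  have "card (inj_funs (\<Union>P) {1..n}) \<le> card {h \<in> \<Union>P \<rightarrow>\<^sub>E {1..n}. \<forall>b\<in>P. inj_on h b}"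
  proof (rule card_mono)
    show "finite {h \<in> \<Union>P \<rightarrow>\<^sub>E {1..n}. \<forall>b\<in>P. inj_on h b}"
      by (rule finite_subset[OF _ finite_PiE[OF blocks_finite_Union[OF P], of "\<lambda>_. {1..n}"]]) auto
  qed (auto simp: inj_funs_def intro: inj_on_subset)
  also have "\<dots> = (\<Prod>b\<in>P. card {h \<in> b \<rightarrow>\<^sub>E {1..n}. inj_on h b})"
    by (rule card_funcset_blocks[OF P], simp, rule inj_on_cong)
  finally show ?thesis by (simp add: inj_funs_def)
qed

definition orbit_embeddings :: "nat \<Rightarrow> 'a set set \<Rightarrow> (nat \<Rightarrow> nat) \<Rightarrow> (nat \<Rightarrow> nat) \<Rightarrow> real" where
  "orbit_embeddings n P p q =
    real (card {f \<in> inj_funs (\<Union>P) {1..n}. \<forall>b\<in>P. f ` b \<in> orbits {p, q} {1..n}})"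

text \<open>Change the denominator first and the numerator afterwards: y/i - z/j = y (j - i)/(i j) -
  (z - y)/j. Here y and i belong to the joint moment, z and j to the product of means.\<close>

lemma ratio_difference_le:
  fixes y z i j e d s t :: real
  assumes "0 \<le> y" "y \<le> z" "z - y \<le> d" "0 < s" "s \<le> i" "i \<le> j" "j - i \<le> t"
  shows "\<bar>y / i - z / j\<bar> \<le> z * t / s ^ 2 + d / s"
proof -
  have pos: "0 < i" "0 < j" using assms by auto
  have "y / i - z / j = y * (j - i) / (i * j) - (z - y) / j" using pos by (simp add: field_simps)
  then have "\<bar>y / i - z / j\<bar> \<le> \<bar>y * (j - i) / (i * j)\<bar> + \<bar>(z - y) / j\<bar>"
    by (simp only: abs_triangle_ineq4)
  also have "\<dots> = y * (j - i) / (i * j) + (z - y) / j" using assms pos by simp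
  also have "\<dots> \<le> z * t / s ^ 2 + d / s"
  proof (rule add_mono)
    show "y * (j - i) / (i * j) \<le> z * t / s ^ 2"
      using assms by (intro frac_le mult_mono) (auto simp: power2_eq_square intro!: mult_mono)
    show "(z - y) / j \<le> d / s" using assms by (intro frac_le) auto
  qed
  finally show ?thesis .
qed

text \<open>The first summand is the constant for 2 M \<le> n; the second bounds n^M D when n < 2
  M.\<close>

definition moment_const :: "nat \<Rightarrow> real" where
  "moment_const M = 4 * 4 ^ M * real M ^ 2 * (2 * real M) ^ (2 * M) + (2 * real M) ^ M * (4 * real M)"

lemma moment_const_nonneg: "0 \<le> moment_const M"
  by (simp add: moment_const_def)

lemma Exp_orbit_embeddings:
  assumes "\<pi> permutes {1..n}" "\<pi>' permutes {1..n}" "finite (\<Union>P)"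
  shows "Exp (conj_class n \<pi>) (conj_class n \<pi>') (orbit_embeddings n P) =
    real (card (glued_pairs n \<pi> \<pi>' P)) / real (card (inj_funs (\<Union>P) {1..n}))"
  unfolding orbit_embeddings_def glued_pairs_def by (rule Exp_card_orbit_embeddings[OF assms])

text \<open>The numerator is at most the square of the denominator. This crude bound serves only n <
  2 M.\<close>

lemma Exp_orbit_embeddings_le:
  assumes "\<pi> permutes {1..n}" "\<pi>' permutes {1..n}" "finite (\<Union>P)"
  shows "Exp (conj_class n \<pi>) (conj_class n \<pi>') (orbit_embeddings n P) \<le> real n ^ card (\<Union>P)"
proof -
  let ?I = "inj_funs (\<Union>P) {1..n}"
  have "card (glued_pairs n \<pi> \<pi>' P) \<le> card (?I \<times> ?I)"
    using assms(3) by (intro card_mono) (auto simp: glued_pairs_def)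
  then have "card (glued_pairs n \<pi> \<pi>' P) \<le> card ?I * card ?I" by (simp only: card_cartesian_product)
  then have "real (card (glued_pairs n \<pi> \<pi>' P)) \<le> real (card ?I) * real (card ?I)"
    by (simp only: of_nat_mult[symmetric] of_nat_le_iff)
  then have "real (card (glued_pairs n \<pi> \<pi>' P)) / real (card ?I) \<le> real (card ?I)"
    by (cases "card ?I = 0") (simp_all add: divide_le_eq)
  also have "\<dots> \<le> real n ^ card (\<Union>P)"
    using card_inj_funs_le[OF assms(3), of n] by (simp only: of_nat_power[symmetric] of_nat_le_iff)
  finally show ?thesis by (simp only: Exp_orbit_embeddings[OF assms])
qed

lemma orbit_embeddings_moment:
  assumes \<pi>: "\<pi> permutes {1..n}" "\<pi>' permutes {1..n}" and P: "blocks P"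
  defines "M \<equiv> card (\<Union>P)"
  defines "E \<equiv> \<lambda>P'. Exp (conj_class n \<pi>) (conj_class n \<pi>') (orbit_embeddings n (P' :: 'a set set))"
  shows "\<bar>E P - (\<Prod>b\<in>P. E {b})\<bar> \<le> moment_const M * (Bconst n \<pi> \<pi>' ^ M / Dconst n \<pi> \<pi>')"
proof -
  let ?F = "cycle_weight n \<pi>" and ?F' = "cycle_weight n \<pi>'"
  let ?B = "Bconst n \<pi> \<pi>'" and ?D = "Dconst n \<pi> \<pi>'"
  let ?Y = "real (card (glued_pairs n \<pi> \<pi>' P))" and ?Z = "real (card (glued_block_pairs n \<pi> \<pi>' P))"
  let ?I = "real (card (inj_funs (\<Union>P) {1..n}))" and ?J = "\<Prod>b\<in>P. real (card (inj_funs b {1..n}))"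
  have fU: "finite (\<Union>P)" by (rule blocks_finite_Union[OF P])
  have fin: "finite (\<Union>{b})" if "b \<in> P" for b using that P by (simp add: blocks_def)
  have D0: "0 \<le> ?D" by (simp add: Dconst_def)
  have B1: "1 \<le> ?B" by (simp add: Bconst_def)
  have EP: "E P = ?Y / ?I" unfolding E_def by (rule Exp_orbit_embeddings[OF \<pi> fU])
  have Eprod: "(\<Prod>b\<in>P. E {b}) = ?Z / ?J"
  proof -
    have "(\<Prod>b\<in>P. E {b}) = (\<Prod>b\<in>P. real (card (glued_pairs n \<pi> \<pi>' {b})) / real (card (inj_funs b {1..n})))"
      unfolding E_def using Exp_orbit_embeddings[OF \<pi> fin] by (intro prod.cong refl) simp
    also have "\<dots> = ?Z / ?J" by (simp add: prod_dividef card_glued_block_pairs[OF P])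
    finally show ?thesis .
  qed
  have E0: "0 \<le> E P'" for P' unfolding E_def Exp_def orbit_embeddings_def by (intro divide_nonneg_nonneg sum_nonneg) auto
  \<comment> \<open>The threshold is chosen so that n - M is at least n/2, which gives (n/2)^M as a
    lower bound for both denominators. For M = 0 there are no blocks and the difference
    vanishes.\<close>
  consider "M = 0" | "1 \<le> M" "n < 2 * M" | "1 \<le> M" "2 * M \<le> n" by linarith
  then show ?thesis
  proof cases
    case 1
    have "P = {}"
    proof (rule equals0I)
      fix b assume b: "b \<in> P"
      have "b = {}" using 1 fU b by (auto simp: M_def)
      then show False using b P by (auto simp: blocks_def)
    qed
    then have "?Y = ?Z" "?I = 1" by (simp_all add: glued_pairs_def glued_block_pairs_def inj_funs_def)
    then have "E P - (\<Prod>b\<in>P. E {b}) = 0" using \<open>P = {}\<close> EP Eprod by simp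
    then show ?thesis using moment_const_nonneg D0 B1 by simp
  next
    case 2
    have "(\<Prod>b\<in>P. E {b}) \<le> (\<Prod>b\<in>P. real n ^ card b)"
      using E0 Exp_orbit_embeddings_le[OF \<pi> fin] by (intro prod_mono) (auto simp: E_def)
    also have "\<dots> = real n ^ M" by (simp add: M_def blocks_card_Union[OF P] power_sum)
    finally have "(\<Prod>b\<in>P. E {b}) \<le> real n ^ M" .
    moreover have "E P \<le> real n ^ M" unfolding E_def M_def by (rule Exp_orbit_embeddings_le[OF \<pi> fU])
    moreover have "0 \<le> (\<Prod>b\<in>P. E {b})" using E0 by (simp add: prod_nonneg)
    ultimately have le: "\<bar>E P - (\<Prod>b\<in>P. E {b})\<bar> \<le> real n ^ M" using E0[of P] by linarith
    \<comment> \<open>For n = 0 also D is 0 and the right side is 0 by the convention for division;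
      the left side is 0 because M is positive.\<close>
    show ?thesis
    proof (cases "n = 0")
      case True
      then have "real n ^ M = 0" using 2 by (simp add: zero_power)
      then have "\<bar>E P - (\<Prod>b\<in>P. E {b})\<bar> \<le> 0" using le by (simp only:)
      also have "0 \<le> moment_const M * (?B ^ M / ?D)" using moment_const_nonneg D0 B1 by simp
      finally show ?thesis .
    next
      case False
      then have D1: "1 \<le> ?D" using Dconst_ge_1 \<pi> by simp
      have "?D \<le> 2 * real n" using cycle_weight_le[of n \<pi>] by (simp add: Dconst_eq)
      also have "\<dots> \<le> 4 * real M" using 2 by simp
      finally have D: "?D \<le> 4 * real M" .
      have "1 \<le> ?B ^ M" using B1 by simp
      have "real n ^ M * ?D \<le> (2 * real M) ^ M * (4 * real M)"
        using 2 D D0 by (intro mult_mono power_mono) auto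
      also have "\<dots> \<le> moment_const M" by (simp add: moment_const_def)
      also have "\<dots> \<le> moment_const M * ?B ^ M"
        using \<open>1 \<le> ?B ^ M\<close> moment_const_nonneg[of M] by (simp add: mult_le_cancel_left1)
      finally have "real n ^ M \<le> moment_const M * ?B ^ M / ?D" using D1 by (simp add: le_divide_eq)
      then show ?thesis using le by simp
    qed
  next
    case 3
    then have n: "1 \<le> n" "0 < real n" by auto
    have F: "1 \<le> ?F" "1 \<le> ?F'" using cycle_weight_ge_1 \<pi> n by auto
    have D1: "1 \<le> ?D" using Dconst_ge_1 \<pi> n by simp
    let ?Q = "(2 * real M) ^ (2 * M)"
    let ?G = "?Q * (?F * ?F') ^ M"
    note G = card_glued_pairs_le[OF \<pi> n(1) P, folded M_def]
    have s: "(real n / 2) ^ M \<le> ?I"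
    proof -
      have "(real n / 2) ^ M \<le> real (n - M) ^ M" using 3 by (intro power_mono) auto
      also have "\<dots> \<le> ?I" using card_inj_funs_ge[OF fU, of n] 3 by (simp add: M_def)
      finally show ?thesis .
    qed
    have IJ: "?I \<le> ?J"
      using card_inj_funs_le_prod[OF P, of n] by (simp only: of_nat_prod[symmetric] of_nat_le_iff)
    have J: "?J \<le> real n ^ M"
    proof -
      have "?J \<le> (\<Prod>b\<in>P. real n ^ card b)"
      proof (intro prod_mono conjI)
        fix b assume "b \<in> P"
        then have "card (inj_funs b {1..n}) \<le> n ^ card b" using P by (intro card_inj_funs_le) (simp add: blocks_def)
        then show "real (card (inj_funs b {1..n})) \<le> real n ^ card b"
          by (simp only: of_nat_power[symmetric] of_nat_le_iff)
      qed simp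
      then show ?thesis by (simp add: M_def blocks_card_Union[OF P] power_sum)
    qed
    \<comment> \<open>Bernoulli's inequality gives (n - M)^M \<ge> n^M (1 - M^2/n), and the joint
      number of injections is at least (n - M)^M.\<close>
    have t: "?J - ?I \<le> real n ^ M * real M ^ 2 / real n"
    proof -
      have "1 + real M * (- (real M / real n)) \<le> (1 + (- (real M / real n))) ^ M"
        using 3 n by (intro Bernoulli_inequality) (simp add: divide_le_eq)
      then have "real n ^ M * (1 - real M ^ 2 / real n) \<le> real n ^ M * (1 - real M / real n) ^ M"
        by (intro mult_left_mono) (simp_all add: power2_eq_square)
      also have "\<dots> = real (n - M) ^ M"
        using 3 n by (simp add: power_mult_distrib[symmetric] right_diff_distrib of_nat_diff)
      also have "\<dots> \<le> ?I" using card_inj_funs_ge[OF fU, of n] 3 by (simp add: M_def)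
      finally show ?thesis using J by (simp add: right_diff_distrib)
    qed
    have "\<bar>?Y / ?I - ?Z / ?J\<bar> \<le> ?Z * (real n ^ M * real M ^ 2 / real n) / ((real n / 2) ^ M) ^ 2 +
        (real M ^ 2 * ?G * (1 / ?F + 1 / ?F')) / (real n / 2) ^ M"
      by (rule ratio_difference_le) (use G s IJ t n in auto)
    also have "\<dots> \<le> ?G * (real n ^ M * real M ^ 2 / real n) / ((real n / 2) ^ M) ^ 2 +
        (real M ^ 2 * ?G * (1 / ?F + 1 / ?F')) / (real n / 2) ^ M"
      using G(2) by (intro add_right_mono divide_right_mono mult_right_mono) auto
    also have "\<dots> = ?Q * (?F * ?F' / real n) ^ M * (4 ^ M * real M ^ 2) * (1 / real n) +
        ?Q * (?F * ?F' / real n) ^ M * (2 ^ M * real M ^ 2) * (1 / ?F + 1 / ?F')"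
    proof -
      have 4: "((2::real) ^ M) ^ 2 = 4 ^ M" by (simp add: power2_eq_square flip: power_mult_distrib)
      have "?G * (real n ^ M * real M ^ 2 / real n) / ((real n / 2) ^ M) ^ 2 =
          ?Q * (?F * ?F' / real n) ^ M * (4 ^ M * real M ^ 2) * (1 / real n)"
        using n(2) by (simp add: power_divide 4[symmetric]) (simp add: field_simps power2_eq_square)
      moreover have "(real M ^ 2 * ?G * (1 / ?F + 1 / ?F')) / (real n / 2) ^ M =
          ?Q * (?F * ?F' / real n) ^ M * (2 ^ M * real M ^ 2) * (1 / ?F + 1 / ?F')"
        using n(2) by (simp add: power_divide)
      ultimately show ?thesis by (simp only:)
    qed
    \<comment> \<open>Uses F F'/n \<le> B, 1/n \<le> 2/D, and 1/F + 1/F' \<le> 2/D; enlarging 2^M to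
      4^M makes the two summands equal, whence the 4 in \<open>moment_const\<close>.\<close>
    also have "\<dots> \<le> ?Q * ?B ^ M * (4 ^ M * real M ^ 2) * (2 / ?D) + ?Q * ?B ^ M * (4 ^ M * real M ^ 2) * (2 / ?D)"
    proof (rule add_mono)
      have FB: "(?F * ?F' / real n) ^ M \<le> ?B ^ M" using F n by (intro power_mono) (auto simp: Bconst_eq)
      have DF: "1 / ?F \<le> 1 / ?D" "1 / ?F' \<le> 1 / ?D"
        using D1 by (auto simp: Dconst_eq intro!: divide_left_mono mult_pos_pos)
      have Dn: "1 / real n \<le> 2 / ?D"
        using cycle_weight_le[of n \<pi>] D1 n by (simp add: Dconst_eq field_simps)
      show "?Q * (?F * ?F' / real n) ^ M * (4 ^ M * real M ^ 2) * (1 / real n) \<le>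
          ?Q * ?B ^ M * (4 ^ M * real M ^ 2) * (2 / ?D)"
        using FB Dn B1 F by (intro mult_mono) auto
      have "(2::real) ^ M \<le> 4 ^ M" by (intro power_mono) auto
      moreover have "1 / ?F + 1 / ?F' \<le> 2 / ?D" using DF by simp
      ultimately show "?Q * (?F * ?F' / real n) ^ M * (2 ^ M * real M ^ 2) * (1 / ?F + 1 / ?F') \<le>
          ?Q * ?B ^ M * (4 ^ M * real M ^ 2) * (2 / ?D)"
        using FB B1 F by (intro mult_mono) auto
    qed
    also have "\<dots> = 4 * 4 ^ M * real M ^ 2 * ?Q * (?B ^ M / ?D)" by (simp add: field_simps)
    also have "\<dots> \<le> moment_const M * (?B ^ M / ?D)"
      using B1 D1 by (intro mult_right_mono) (auto simp: moment_const_def)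
    finally show ?thesis by (simp only: EP Eprod)
  qed
qed


section \<open>Factorial moments\<close>

text \<open>Both moments carry the same product of factorials as a factor; since it is at least 1,
  dividing it out keeps the bound.\<close>

lemma abs_diff_scaled_le:
  assumes "x = a / c" "y = b / c" "(1::real) \<le> c" "\<bar>a - b\<bar> \<le> e"
  shows "\<bar>x - y\<bar> \<le> e"
proof -
  have "\<bar>x - y\<bar> = \<bar>a - b\<bar> / c" using assms(1-3) by (simp add: diff_divide_distrib[symmetric])
  also have "\<dots> \<le> \<bar>a - b\<bar>" using assms(3) by (simp add: divide_le_eq mult_le_cancel_left1)
  finally show ?thesis using assms(4) by linarith
qed

text \<open>A concrete choice of the abstract blocks: i is the size and s the number of the copy.
  Both are stored in the points, so distinct blocks are disjoint by construction.\<close>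

definition block_family :: "nat \<Rightarrow> (nat \<Rightarrow> nat) \<Rightarrow> (nat \<times> nat \<times> nat) set set" where
  "block_family k m = (\<lambda>(i, s). {i} \<times> {s} \<times> {..<i}) ` (SIGMA i:{1..k}. {..<m i})"

lemma block_family_inj: "inj_on (\<lambda>(i, s). {i} \<times> {s} \<times> {..<i}) (SIGMA i:{1..k::nat}. {..<m i :: nat})"
proof (rule inj_onI, clarify)
  fix i s i' s' :: nat
  assume i: "i \<in> {1..k}" and eq: "{i} \<times> {s} \<times> {..<i} = {i'} \<times> {s'} \<times> {..<i'}"
  \<comment> \<open>Since i is at least 1, the block contains a point, from which both labels can be
    read off.\<close>
  have "(i, s, 0) \<in> {i} \<times> {s} \<times> {..<i}" using i by auto
  then show "i = i' \<and> s = s'" unfolding eq by auto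
qed

lemma blocks_block_family: "blocks (block_family k m)"
  unfolding blocks_def block_family_def disjoint_def by (auto simp: lessThan_empty_iff)

lemma card_block_family_size: "i \<in> {1..k} \<Longrightarrow> card {b \<in> block_family k m. card b = i} = m i"
proof -
  assume i: "i \<in> {1..k}"
  have "{b \<in> block_family k m. card b = i} = (\<lambda>(i, s). {i} \<times> {s} \<times> {..<i}) ` ({i} \<times> {..<m i})"
    using i by (auto simp: block_family_def image_iff)
  moreover have "inj_on (\<lambda>(i, s). {i} \<times> {s} \<times> {..<i}) ({i} \<times> {..<m i})"
    by (rule inj_on_subset[OF block_family_inj[of k m]]) (use i in auto)
  ultimately show ?thesis by (simp add: card_image)
qed

lemma prod_block_family: "(\<Prod>b\<in>block_family k m. g (card b)) = (\<Prod>i=1..k. (g i :: real) ^ m i)"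
proof -
  have "(\<Prod>b\<in>block_family k m. g (card b)) = (\<Prod>p\<in>(SIGMA i:{1..k}. {..<m i}). g (fst p))"
    unfolding block_family_def by (subst prod.reindex[OF block_family_inj]) (auto intro!: prod.cong)
  also have "\<dots> = (\<Prod>i=1..k. \<Prod>s<m i. g i)" by (subst prod.Sigma) (auto simp: case_prod_beta)
  finally show ?thesis by simp
qed

lemma card_block_family: "card (\<Union>(block_family k m)) = (\<Sum>i=1..k. m i * i)"
proof -
  have "(\<Sum>b\<in>block_family k m. card b) = (\<Sum>p\<in>(SIGMA i:{1..k}. {..<m i}). fst p)"
    unfolding block_family_def by (subst sum.reindex[OF block_family_inj]) (auto intro!: sum.cong)
  also have "\<dots> = (\<Sum>i=1..k. \<Sum>s<m i. i)" by (subst sum.Sigma) (auto simp: case_prod_beta)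
  finally show ?thesis by (simp add: blocks_card_Union[OF blocks_block_family])
qed

lemma conj_class_permutes: "p \<in> conj_class n \<pi> \<Longrightarrow> \<pi> permutes {1..n} \<Longrightarrow> p permutes {1..n}"
  by (auto simp: conj_class_def intro: permutes_conj)

lemma Exp_cong:
  assumes "\<And>p q. p \<in> C \<Longrightarrow> q \<in> C' \<Longrightarrow> X p q = Y p q"
  shows "Exp C C' X = Exp C C' Y"
  unfolding Exp_def using assms by (intro arg_cong2[where f = "(/)"] sum.cong) auto

lemma Exp_scale: "Exp C C' (\<lambda>p q. X p q * c) = Exp C C' X * c"
  by (simp add: Exp_def sum_distrib_right)

text \<open>The whole family gives the joint factorial moment, a single block gives a mean because
  (x)_1 = x, and in both cases the labellings contribute the same product of powers of
  factorials.\<close>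

lemma moment_bound:
  assumes \<pi>: "\<pi> permutes {1..n}" "\<pi>' permutes {1..n}" and M: "M = (\<Sum>i=1..k. m i * i)"
  shows "\<bar>Exp (conj_class n \<pi>) (conj_class n \<pi>') (\<lambda>p q. \<Prod>i=1..k. falling (real (N n p q i)) (m i))
       - (\<Prod>i=1..k. (Exp (conj_class n \<pi>) (conj_class n \<pi>') (\<lambda>p q. real (N n p q i))) ^ m i)\<bar>
     \<le> moment_const M * (Bconst n \<pi> \<pi>' ^ M / Dconst n \<pi> \<pi>')"
proof -
  let ?C = "conj_class n \<pi>" and ?C' = "conj_class n \<pi>'" and ?P = "block_family k m"
  let ?c = "\<Prod>i=1..k. (fact i :: real) ^ m i"
  have count: "orbit_embeddings n P p q = (\<Prod>i\<in>I. falling (real (N n p q i)) (card {b \<in> P. card b = i}) *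
        fact i ^ card {b \<in> P. card b = i})"
    if "p \<in> ?C" "q \<in> ?C'" "blocks P" "finite I" "card ` P \<subseteq> I" for p q I and P :: "(nat \<times> nat \<times> nat) set set"
    unfolding orbit_embeddings_def N_def using that conj_class_permutes \<pi>
    by (intro card_orbit_embeddings) auto
  have sub: "card ` ?P \<subseteq> {1..k}" by (auto simp: block_family_def)
  have "Exp ?C ?C' (orbit_embeddings n ?P) = Exp ?C ?C' (\<lambda>p q. (\<Prod>i=1..k. falling (real (N n p q i)) (m i)) * ?c)"
  proof (rule Exp_cong)
    fix p q assume pq: "p \<in> ?C" "q \<in> ?C'"
    show "orbit_embeddings n ?P p q = (\<Prod>i=1..k. falling (real (N n p q i)) (m i)) * ?c"
      unfolding count[OF pq blocks_block_family finite_atLeastAtMost sub] prod.distrib[symmetric]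
      by (intro prod.cong refl) (simp only: card_block_family_size)
  qed
  then have joint: "Exp ?C ?C' (orbit_embeddings n ?P) =
      Exp ?C ?C' (\<lambda>p q. \<Prod>i=1..k. falling (real (N n p q i)) (m i)) * ?c"
    by (simp only: Exp_scale)
  have single: "Exp ?C ?C' (orbit_embeddings n {b}) = Exp ?C ?C' (\<lambda>p q. real (N n p q (card b))) * fact (card b)"
    if b: "b \<in> ?P" for b
  proof -
    have bl: "blocks {b}" using b blocks_block_family[of k m] by (simp add: blocks_def disjoint_def)
    have one: "card {c \<in> {b}. card c = card b} = 1"
    proof -
      have "{c \<in> {b}. card c = card b} = {b}" by auto
      then show ?thesis by simp
    qed
    have "Exp ?C ?C' (orbit_embeddings n {b}) = Exp ?C ?C' (\<lambda>p q. real (N n p q (card b)) * fact (card b))"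
    proof (rule Exp_cong)
      fix p q assume pq: "p \<in> ?C" "q \<in> ?C'"
      have "orbit_embeddings n {b} p q = (\<Prod>i\<in>{card b}. falling (real (N n p q i)) (card {c \<in> {b}. card c = i}) *
          fact i ^ card {c \<in> {b}. card c = i})"
        by (rule count[OF pq bl]) auto
      also have "\<dots> = real (N n p q (card b)) * fact (card b)"
      proof -
        have "(\<Prod>i\<in>{a}. g i) = g a" for a and g :: "nat \<Rightarrow> real" by simp
        moreover have "falling x 1 = x" for x by (simp add: falling_def)
        ultimately show ?thesis by (simp only: one power_one_right)
      qed
      finally show "orbit_embeddings n {b} p q = real (N n p q (card b)) * fact (card b)" .
    qed
    then show ?thesis by (simp only: Exp_scale)
  qed
  have "(\<Prod>b\<in>?P. Exp ?C ?C' (orbit_embeddings n {b})) =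
      (\<Prod>b\<in>?P. Exp ?C ?C' (\<lambda>p q. real (N n p q (card b))) * fact (card b))"
    by (intro prod.cong refl single)
  also have "\<dots> = (\<Prod>i=1..k. (Exp ?C ?C' (\<lambda>p q. real (N n p q i)) * fact i) ^ m i)"
    by (rule prod_block_family[where g = "\<lambda>i. Exp ?C ?C' (\<lambda>p q. real (N n p q i)) * fact i"])
  also have "\<dots> = (\<Prod>i=1..k. (Exp ?C ?C' (\<lambda>p q. real (N n p q i))) ^ m i) * ?c"
    by (simp add: power_mult_distrib prod.distrib)
  finally have prod: "(\<Prod>b\<in>?P. Exp ?C ?C' (orbit_embeddings n {b})) =
      (\<Prod>i=1..k. (Exp ?C ?C' (\<lambda>p q. real (N n p q i))) ^ m i) * ?c" .
  have c: "1 \<le> ?c" by (intro prod_ge_1 one_le_power fact_ge_1)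
  show ?thesis
  proof (rule abs_diff_scaled_le[OF _ _ c])
    show "Exp ?C ?C' (\<lambda>p q. \<Prod>i=1..k. falling (real (N n p q i)) (m i)) =
        Exp ?C ?C' (orbit_embeddings n ?P) / ?c"
      using c unfolding joint by simp
    show "(\<Prod>i=1..k. (Exp ?C ?C' (\<lambda>p q. real (N n p q i))) ^ m i) =
        (\<Prod>b\<in>?P. Exp ?C ?C' (orbit_embeddings n {b})) / ?c"
      using c unfolding prod by simp
    show "\<bar>Exp ?C ?C' (orbit_embeddings n ?P) - (\<Prod>b\<in>?P. Exp ?C ?C' (orbit_embeddings n {b}))\<bar>
        \<le> moment_const M * (Bconst n \<pi> \<pi>' ^ M / Dconst n \<pi> \<pi>')"
      using orbit_embeddings_moment[OF \<pi> blocks_block_family[of k m]] by (simp only: card_block_family M)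
  qed
qed

text \<open>The multinomial Vandermonde identity. Summing over words instead of multiplicity vectors
  avoids multinomial coefficients: appending the letter y multiplies a term by x_y minus the
  multiplicity of y.\<close>

lemma falling_sum:
  fixes x :: "'a \<Rightarrow> real"
  assumes I: "finite I"
  shows "falling (\<Sum>i\<in>I. x i) m = (\<Sum>a\<in>{..<m} \<rightarrow>\<^sub>E I. \<Prod>i\<in>I. falling (x i) (card {j \<in> {..<m}. a j = i}))"
proof (induction m)
  case 0
  have "card {j \<in> {..<0::nat}. a j = i} = 0" for a :: "nat \<Rightarrow> 'a" and i by simp
  then show ?case by (simp add: falling_def)
next
  case (Suc m)
  let ?t = "\<lambda>m a i. card {j \<in> {..<m}. a j = (i :: 'a)}"
  have t: "?t (Suc m) (a(m := y)) i = (if i = y then Suc (?t m a i) else ?t m a i)" for a y i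
  proof -
    have "{j \<in> {..<Suc m}. (a(m := y)) j = i} = (if i = y then insert m {j \<in> {..<m}. a j = i} else {j \<in> {..<m}. a j = i})"
      by (auto simp: less_Suc_eq)
    then show ?thesis by simp
  qed
  have step: "(\<Prod>i\<in>I. falling (x i) (?t (Suc m) (a(m := y)) i)) = (\<Prod>i\<in>I. falling (x i) (?t m a i)) * (x y - real (?t m a y))"
    if y: "y \<in> I" for a y
  proof -
    have "(\<Prod>i\<in>I. falling (x i) (?t (Suc m) (a(m := y)) i)) =
        (\<Prod>i\<in>I. falling (x i) (?t m a i) * (if i = y then x y - real (?t m a y) else 1))"
      by (intro prod.cong refl) (simp only: t falling_Suc split: if_split, simp)
    then show ?thesis using I y by (simp add: prod.distrib)
  qed
  \<comment> \<open>The multiplicities of a word add up to its length m, which is the shift in the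
    next factor of the falling factorial.\<close>
  have total: "(\<Sum>i\<in>I. ?t m a i) = m" if "a \<in> {..<m} \<rightarrow>\<^sub>E I" for a
  proof -
    have "(\<Sum>i\<in>I. ?t m a i) = (\<Sum>i\<in>I. \<Sum>j | j \<in> {..<m} \<and> a j = i. 1)" by simp
    also have "\<dots> = (\<Sum>j<m. 1)" by (rule sum.group) (use I that in auto)
    finally show ?thesis by simp
  qed
  have "(\<Sum>a\<in>{..<Suc m} \<rightarrow>\<^sub>E I. \<Prod>i\<in>I. falling (x i) (?t (Suc m) a i)) =
      (\<Sum>p\<in>I \<times> ({..<m} \<rightarrow>\<^sub>E I). \<Prod>i\<in>I. falling (x i) (?t (Suc m) ((snd p)(m := fst p)) i))"
  proof -
    have inj: "inj_on (\<lambda>(y, a). a(m := y)) (I \<times> ({..<m} \<rightarrow>\<^sub>E I))" by (rule inj_combinator) simp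
    have "{..<Suc m} \<rightarrow>\<^sub>E I = (\<lambda>(y, a). a(m := y)) ` (I \<times> ({..<m} \<rightarrow>\<^sub>E I))"
      by (simp only: lessThan_Suc PiE_insert_eq)
    then show ?thesis by (simp only: sum.reindex[OF inj] o_def case_prod_beta)
  qed
  also have "\<dots> = (\<Sum>p\<in>I \<times> ({..<m} \<rightarrow>\<^sub>E I). (\<Prod>i\<in>I. falling (x i) (?t m (snd p) i)) * (x (fst p) - real (?t m (snd p) (fst p))))"
  proof (rule sum.cong[OF refl])
    fix p assume "p \<in> I \<times> ({..<m} \<rightarrow>\<^sub>E I)"
    then have "fst p \<in> I" by (simp only: mem_Times_iff)
    then show "(\<Prod>i\<in>I. falling (x i) (?t (Suc m) ((snd p)(m := fst p)) i)) =
        (\<Prod>i\<in>I. falling (x i) (?t m (snd p) i)) * (x (fst p) - real (?t m (snd p) (fst p)))"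
      by (rule step[of "fst p" "snd p"])
  qed
  also have "\<dots> = (\<Sum>y\<in>I. \<Sum>a\<in>{..<m} \<rightarrow>\<^sub>E I. (\<Prod>i\<in>I. falling (x i) (?t m a i)) * (x y - real (?t m a y)))"
    by (simp add: sum.cartesian_product case_prod_beta)
  also have "\<dots> = (\<Sum>a\<in>{..<m} \<rightarrow>\<^sub>E I. \<Sum>y\<in>I. (\<Prod>i\<in>I. falling (x i) (?t m a i)) * (x y - real (?t m a y)))"
    by (rule sum.swap)
  also have "\<dots> = (\<Sum>a\<in>{..<m} \<rightarrow>\<^sub>E I. (\<Prod>i\<in>I. falling (x i) (?t m a i)) * ((\<Sum>i\<in>I. x i) - real m))"
  proof (rule sum.cong[OF refl])
    fix a assume a: "a \<in> {..<m} \<rightarrow>\<^sub>E I"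
    have "(\<Sum>y\<in>I. x y - real (?t m a y)) = (\<Sum>i\<in>I. x i) - real (\<Sum>i\<in>I. ?t m a i)"
      by (simp only: sum_subtractf of_nat_sum)
    then show "(\<Sum>y\<in>I. (\<Prod>i\<in>I. falling (x i) (?t m a i)) * (x y - real (?t m a y))) =
        (\<Prod>i\<in>I. falling (x i) (?t m a i)) * ((\<Sum>i\<in>I. x i) - real m)"
      by (simp only: sum_distrib_left[symmetric] total[OF a])
  qed
  also have "\<dots> = falling (\<Sum>i\<in>I. x i) (Suc m)"
    by (simp only: sum_distrib_right[symmetric] Suc.IH falling_Suc)
  finally show ?case by simp
qed

text \<open>The power is expanded over the same words with the same multiplicities as the falling
  factorial, so the two sums can be compared term by term.\<close>

lemma power_sum_functions:
  fixes x :: "'a \<Rightarrow> real"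
  assumes I: "finite I"
  shows "(\<Sum>i\<in>I. x i) ^ m = (\<Sum>a\<in>{..<m} \<rightarrow>\<^sub>E I. \<Prod>i\<in>I. x i ^ card {j \<in> {..<m}. a j = i})"
proof -
  have "(\<Sum>i\<in>I. x i) ^ m = (\<Prod>j<m. \<Sum>i\<in>I. x i)" by simp
  also have "\<dots> = (\<Sum>a\<in>{..<m} \<rightarrow>\<^sub>E I. \<Prod>j<m. x (a j))" using I by (intro prod_sum_PiE) auto
  also have "\<dots> = (\<Sum>a\<in>{..<m} \<rightarrow>\<^sub>E I. \<Prod>i\<in>I. x i ^ card {j \<in> {..<m}. a j = i})"
  proof (rule sum.cong[OF refl])
    fix a assume a: "a \<in> {..<m} \<rightarrow>\<^sub>E I"
    have "(\<Prod>j<m. x (a j)) = (\<Prod>i\<in>I. \<Prod>j | j \<in> {..<m} \<and> a j = i. x (a j))"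
      by (rule prod.group[symmetric]) (use I a in auto)
    also have "\<dots> = (\<Prod>i\<in>I. \<Prod>j | j \<in> {..<m} \<and> a j = i. x i)" by (intro prod.cong refl) auto
    finally show "(\<Prod>j<m. x (a j)) = (\<Prod>i\<in>I. x i ^ card {j \<in> {..<m}. a j = i})" by simp
  qed
  finally show ?thesis .
qed

lemma Exp_sum: "Exp C C' (\<lambda>p q. \<Sum>a\<in>A. X a p q) = (\<Sum>a\<in>A. Exp C C' (X a))"
  unfolding Exp_eq_average average_sum ..

text \<open>Here 1/D is relaxed to the stated exponent, using D \<ge> 1. For n = 0, D is 0 and both
  quotients are 0.\<close>

lemma inverse_Dconst_le:
  assumes "\<pi> permutes {1..n}" "\<pi>' permutes {1..n}" and b: "0 \<le> b"
  shows "b / Dconst n \<pi> \<pi>' \<le> b / Dconst n \<pi> \<pi>' powr (2/3)"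
proof (cases "n = 0")
  case True
  then have "Dconst n \<pi> \<pi>' = 0" using cycle_weight_le[of n \<pi>] cycle_weight_le[of n \<pi>']
    by (simp add: Dconst_def total_cycles_def cycle_count_def num_orbits_of_size_def orbits_def)
  then show ?thesis by simp
next
  case False
  then have D: "1 \<le> Dconst n \<pi> \<pi>'" using Dconst_ge_1 assms by simp
  then have "Dconst n \<pi> \<pi>' powr (2/3) \<le> Dconst n \<pi> \<pi>' powr 1" by (intro powr_mono) auto
  then show ?thesis using D b by (intro divide_left_mono) auto
qed


lemma moment_bound_powr:
  assumes \<pi>: "\<pi> permutes {1..n}" "\<pi>' permutes {1..n}" and M: "M = (\<Sum>i=1..k. m i * i)"
  shows "\<bar>Exp (conj_class n \<pi>) (conj_class n \<pi>') (\<lambda>p q. \<Prod>i=1..k. falling (real (N n p q i)) (m i))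
       - (\<Prod>i=1..k. (Exp (conj_class n \<pi>) (conj_class n \<pi>') (\<lambda>p q. real (N n p q i))) ^ m i)\<bar>
     \<le> moment_const M * Bconst n \<pi> \<pi>' ^ M / Dconst n \<pi> \<pi>' powr (2/3)"
proof -
  have "0 \<le> moment_const M * Bconst n \<pi> \<pi>' ^ M"
    using moment_const_nonneg by (intro mult_nonneg_nonneg zero_le_power) (auto simp: Bconst_def)
  from inverse_Dconst_le[OF \<pi> this] moment_bound[OF \<pi> M] show ?thesis by simp
qed

lemma cumulative_moment_bound:
  fixes k m :: nat
  assumes \<pi>: "\<pi> permutes {1..n}" "\<pi>' permutes {1..n}"
  defines "T \<equiv> \<lambda>a i. card {j \<in> {..<m}. a j = (i :: nat)}"
  shows "\<bar>Exp (conj_class n \<pi>) (conj_class n \<pi>') (\<lambda>p q. falling (real (\<Sum>i=1..k. N n p q i)) m)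
       - (Exp (conj_class n \<pi>) (conj_class n \<pi>') (\<lambda>p q. real (\<Sum>i=1..k. N n p q i))) ^ m\<bar>
     \<le> (\<Sum>a\<in>{..<m} \<rightarrow>\<^sub>E {1..k}. moment_const (\<Sum>i=1..k. T a i * i)) *
        Bconst n \<pi> \<pi>' ^ (k * m) / Dconst n \<pi> \<pi>' powr (2/3)"
proof -
  let ?C = "conj_class n \<pi>" and ?C' = "conj_class n \<pi>'" and ?A = "{..<m} \<rightarrow>\<^sub>E {1..k}"
  let ?B = "Bconst n \<pi> \<pi>'" and ?D = "Dconst n \<pi> \<pi>' powr (2/3)"
  let ?M = "\<lambda>a. \<Sum>i=1..k. T a i * i"
  let ?L = "\<lambda>a. Exp ?C ?C' (\<lambda>p q. \<Prod>i=1..k. falling (real (N n p q i)) (T a i))"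
  let ?R = "\<lambda>a. \<Prod>i=1..k. (Exp ?C ?C' (\<lambda>p q. real (N n p q i))) ^ T a i"
  have B: "1 \<le> ?B" by (simp add: Bconst_def)
  \<comment> \<open>The weight of a word is the sum of its letters: m letters, each at most k. As B
    \<ge> 1, the exponent may then be raised to k m.\<close>
  have M: "?M a \<le> k * m" if a: "a \<in> ?A" for a
  proof -
    have "?M a = (\<Sum>i=1..k. \<Sum>j | j \<in> {..<m} \<and> a j = i. a j)" by (simp add: T_def)
    also have "\<dots> = (\<Sum>j<m. a j)" by (rule sum.group) (use a in auto)
    also have "\<dots> \<le> (\<Sum>j<m. k)" by (rule sum_mono) (use PiE_mem[OF a] in auto)
    finally show ?thesis by (simp add: mult.commute)
  qed
  have "Exp ?C ?C' (\<lambda>p q. falling (real (\<Sum>i=1..k. N n p q i)) m) = (\<Sum>a\<in>?A. ?L a)"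
    by (simp only: of_nat_sum falling_sum[OF finite_atLeastAtMost] Exp_sum T_def)
  moreover have "(Exp ?C ?C' (\<lambda>p q. real (\<Sum>i=1..k. N n p q i))) ^ m = (\<Sum>a\<in>?A. ?R a)"
    by (simp only: of_nat_sum power_sum_functions[OF finite_atLeastAtMost] Exp_sum T_def)
  ultimately have "\<bar>Exp ?C ?C' (\<lambda>p q. falling (real (\<Sum>i=1..k. N n p q i)) m)
      - (Exp ?C ?C' (\<lambda>p q. real (\<Sum>i=1..k. N n p q i))) ^ m\<bar> = \<bar>\<Sum>a\<in>?A. ?L a - ?R a\<bar>"
    by (simp only: sum_subtractf)
  also have "\<dots> \<le> (\<Sum>a\<in>?A. \<bar>?L a - ?R a\<bar>)" by (rule sum_abs)
  also have "\<dots> \<le> (\<Sum>a\<in>?A. moment_const (?M a) * ?B ^ (k * m) / ?D)"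
  proof (rule sum_mono)
    fix a assume a: "a \<in> ?A"
    have "\<bar>?L a - ?R a\<bar> \<le> moment_const (?M a) * ?B ^ ?M a / ?D"
      by (rule moment_bound_powr[OF \<pi> refl])
    also have "\<dots> \<le> moment_const (?M a) * ?B ^ (k * m) / ?D"
      by (intro divide_right_mono mult_left_mono power_increasing M a B moment_const_nonneg) simp
    finally show "\<bar>?L a - ?R a\<bar> \<le> moment_const (?M a) * ?B ^ (k * m) / ?D" .
  qed
  also have "\<dots> = (\<Sum>a\<in>?A. moment_const (?M a)) * ?B ^ (k * m) / ?D"
    by (simp only: sum_distrib_right sum_divide_distrib)
  finally show ?thesis .
qed

text \<open>The existential constants are fixed by unification: \<open>moment_const M\<close> for
  the joint moments, and its sum over all words, which involves only k and m, for the cumulative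
  count.\<close>

theorem theorem3p9:
  shows "(\<forall>M::nat. \<exists>C::real. \<forall>k::nat. \<forall>m::nat \<Rightarrow> nat. \<forall>n::nat. \<forall>\<pi>0 \<pi>0'.
            k \<ge> 1 \<longrightarrow> M = (\<Sum>i=1..k. m i * i) \<longrightarrow>
            \<pi>0 permutes {1..n} \<longrightarrow> \<pi>0' permutes {1..n} \<longrightarrow>
            \<bar>Exp (conj_class n \<pi>0) (conj_class n \<pi>0')
                 (\<lambda>\<pi> \<pi>'. \<Prod>i=1..k. falling (real (N n \<pi> \<pi>' i)) (m i))
             - (\<Prod>i=1..k. (Exp (conj_class n \<pi>0) (conj_class n \<pi>0')
                              (\<lambda>\<pi> \<pi>'. real (N n \<pi> \<pi>' i))) ^ m i)\<bar>
            \<le> C * Bconst n \<pi>0 \<pi>0' ^ M / Dconst n \<pi>0 \<pi>0' powr (2/3))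
       \<and> (\<forall>k::nat. \<forall>m::nat. k \<ge> 1 \<longrightarrow> m \<ge> 1 \<longrightarrow>
          (\<exists>C::real. \<forall>n::nat. \<forall>\<pi>0 \<pi>0'.
            \<pi>0 permutes {1..n} \<longrightarrow> \<pi>0' permutes {1..n} \<longrightarrow>
            \<bar>Exp (conj_class n \<pi>0) (conj_class n \<pi>0')
                 (\<lambda>\<pi> \<pi>'. falling (real (\<Sum>i=1..k. N n \<pi> \<pi>' i)) m)
             - (Exp (conj_class n \<pi>0) (conj_class n \<pi>0')
                  (\<lambda>\<pi> \<pi>'. real (\<Sum>i=1..k. N n \<pi> \<pi>' i))) ^ m\<bar>
            \<le> C * Bconst n \<pi>0 \<pi>0' ^ (k * m) / Dconst n \<pi>0 \<pi>0' powr (2/3)))"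
  by (rule conjI; intro allI impI; rule exI; intro allI impI;
      (rule moment_bound_powr | rule cumulative_moment_bound); assumption)

end
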